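(* Let $\sigma,\omega\in\mathcal{W}$ be two quasianalytic weight functions. (Roumieu case) If $\omega$ satisfies $\omega(t)=O(t)$ as $t\to+\infty$ and $\liminf_{t\to+\infty}\frac{\omega(t)}{t}=0$, then $\mathcal{F}_{\{\omega\}}\setminus j^\infty(\mathcal{E}^0_{\{\sigma\}})$ is $\mathfrak{c}$-algebrable in $\mathcal{F}_{\{\omega\}}$ endowed with the Cauchy product (hence $\mathcal{F}_{\{\omega\}}\setminus j^\infty(\mathcal{E}^0_{(\sigma)})$ too). (Beurling case) If $\omega$ satisfies $\omega(t)=o(t)$ as $t\to+\infty$, then $\mathcal{F}_{(\omega)}\setminus j^\infty(\mathcal{E}^0_{\{\sigma\}})$ is $\mathfrak{c}$-algebrable in $\mathcal{F}_{(\omega)}$ endowed with the Cauchy product (hence $\mathcal{F}_{(\omega)}\setminus j^\infty(\mathcal{E}^0_{(\sigma)})$ too).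
   Context: $\mathbb{N}=\{0,1,2,\dots\}$; $\mathfrak{c}$ is the cardinality of the continuum. A weight function is a continuous, increasing (i.e. nondecreasing) function $\omega:[0,+\infty)\to[0,+\infty)$ with $\omega(t)=0$ for $t\in[0,1]$ and $\lim_{t\to+\infty}\omega(t)=+\infty$. $\mathcal{W}$ is the set of weight functions $\omega$ such that: $\omega(2t)=O(\omega(t))$ as $t\to+\infty$; $\log(t)=o(\omega(t))$ as $t\to+\infty$; and $\varphi_\omega:t\mapsto\omega(e^t)$ is convex on $\mathbb{R}$. A weight function is quasianalytic if $\int_1^{+\infty}\frac{\omega(t)}{t^2}\,dt=+\infty$. For $\omega\in\mathcal{W}$ let $\varphi^*_\omega(x):=\sup\{xy-\varphi_\omega(y):y\ge0\}$, $x\ge0$. For $U\subseteq\mathbb{R}$ nonempty open, $\mathcal{E}_{\{\omega\}}(U)$, resp. $\mathcal{E}_{(\omega)}(U)$, is the set of complex-valued smooth $f$ on $U$ such that for every compact $K\subseteq U$ and for some $l>0$, resp. for all $l>0$, $\sup_{j\in\mathbb{N},x\in K}\frac{|f^{(j)}(x)|}{\exp(\frac1l\varphi^*_\omega(lj))}<+\infty$. $\mathcal{E}^0_{\{\omega\}}$, $\mathcal{E}^0_{(\omega)}$ are the corresponding spaces of germs at $0$, i.e. $\varinjlim_k$ of the spaces on $(-\frac1k,\frac1k)$. $\mathcal{F}_{\{\omega\}}$, resp. $\mathcal{F}_{(\omega)}$, is the space of formal power series $\mathbf{F}=\sum_{j\ge0}F_jx^j$ with complex coefficients such that for some $l>0$,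 resp. for all $l>0$, $\sup_j\frac{|F_j|\,j!}{\exp(\frac1l\varphi^*_\omega(lj))}<+\infty$. The Borel map is $j^\infty(f)=\sum_{j\ge0}\frac{f^{(j)}(0)}{j!}x^j$. The Cauchy product is $\mathbf{F}\ast\mathbf{G}=\sum_{j\ge0}\big(\sum_{r=0}^jF_rG_{j-r}\big)x^j$; under it $\mathcal{F}_{\{\omega\}}$ and $\mathcal{F}_{(\omega)}$ are algebras. A subset $\mathcal{B}$ of an algebra $\mathcal{A}$ is $\kappa$-algebrable if there is a $\kappa$-generated subalgebra $\mathcal{C}$ of $\mathcal{A}$ (not required to contain a unit) with $\mathcal{C}\subseteq\mathcal{B}\cup\{0\}$; $\kappa$-generated means that $\mathcal{C}$ has a minimal system of generators of cardinality $\kappa$. *)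

theory Defs
  imports
    "HOL-Analysis.Analysis"
    "HOL-Library.Landau_Symbols"
    "HOL-Library.Equipollence"
    "HOL-Computational_Algebra.Formal_Power_Series"
begin

section \<open>Weight functions\<close>

text \<open>A function on \<open>[0, +\<infinity>)\<close> is represented by a function on the reals; no definition below
  depends on its values at negative arguments.\<close>

definition weight_function :: "(real \<Rightarrow> real) \<Rightarrow> bool" where
  "weight_function \<omega> \<longleftrightarrow>
     continuous_on {0..} \<omega> \<and> mono_on {0..} \<omega> \<and> (\<forall>t\<ge>0. 0 \<le> \<omega> t) \<and>
     (\<forall>t\<in>{0..1}. \<omega> t = 0) \<and> filterlim \<omega> at_top at_top"

definition phi :: "(real \<Rightarrow> real) \<Rightarrow> real \<Rightarrow> real" where
  "phi \<omega> t = \<omega> (exp t)"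

definition weight_class :: "(real \<Rightarrow> real) set" where
  "weight_class = {\<omega>. weight_function \<omega> \<and>
     (\<lambda>t. \<omega> (2 * t)) \<in> O[at_top](\<omega>) \<and>
     ln \<in> o[at_top](\<omega>) \<and>
     convex_on UNIV (phi \<omega>)}"

definition quasianalytic :: "(real \<Rightarrow> real) \<Rightarrow> bool" where
  "quasianalytic \<omega> \<longleftrightarrow> (\<integral>\<^sup>+ t \<in> {1..}. ennreal (\<omega> t / t ^ 2) \<partial>lborel) = \<infinity>"

text \<open>The supremum is taken in the reals; it is finite for members of the weight class, see
  \<open>phi_star_bdd\<close> below.\<close>

definition phi_star :: "(real \<Rightarrow> real) \<Rightarrow> real \<Rightarrow> real" where
  "phi_star \<omega> x = (SUP y\<in>{0..}. x * y - phi \<omega> y)"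

definition weight_seq :: "(real \<Rightarrow> real) \<Rightarrow> real \<Rightarrow> nat \<Rightarrow> real" where
  "weight_seq \<omega> l j = exp (1 / l * phi_star \<omega> (l * real j))"


section \<open>Ultradifferentiable functions and germs\<close>

definition nth_deriv :: "nat \<Rightarrow> (real \<Rightarrow> complex) \<Rightarrow> real \<Rightarrow> complex" where
  "nth_deriv j f = ((\<lambda>g x. vector_derivative g (at x)) ^^ j) f"

text \<open>A function on an open set \<open>U\<close> is represented by a function on the reals; for open \<open>U\<close> the
  following notions depend only on its values on \<open>U\<close>.\<close>

definition smooth_on :: "(real \<Rightarrow> complex) \<Rightarrow> real set \<Rightarrow> bool" where
  "smooth_on f U \<longleftrightarrow> (\<forall>j. \<forall>x\<in>U. nth_deriv j f differentiable (at x))"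

definition deriv_bound :: "(real \<Rightarrow> real) \<Rightarrow> real \<Rightarrow> real set \<Rightarrow> (real \<Rightarrow> complex) \<Rightarrow> bool" where
  "deriv_bound \<omega> l K f \<longleftrightarrow>
     bdd_above ((\<lambda>(j, x). norm (nth_deriv j f x) / weight_seq \<omega> l j) ` (UNIV \<times> K))"

definition E_Roumieu :: "(real \<Rightarrow> real) \<Rightarrow> real set \<Rightarrow> (real \<Rightarrow> complex) set" where
  "E_Roumieu \<omega> U = {f. smooth_on f U \<and>
     (\<forall>K. compact K \<and> K \<subseteq> U \<longrightarrow> (\<exists>l>0. deriv_bound \<omega> l K f))}"

definition E_Beurling :: "(real \<Rightarrow> real) \<Rightarrow> real set \<Rightarrow> (real \<Rightarrow> complex) set" where
  "E_Beurling \<omega> U = {f. smooth_on f U \<and>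
     (\<forall>K. compact K \<and> K \<subseteq> U \<longrightarrow> (\<forall>l>0. deriv_bound \<omega> l K f))}"

definition germ0 :: "(real \<Rightarrow> complex) \<Rightarrow> (real \<Rightarrow> complex) set" where
  "germ0 f = {g. \<forall>\<^sub>F x in nhds 0. g x = f x}"

text \<open>The direct limit over \<open>k\<close> of function spaces on \<open>(-1/k, 1/k)\<close> along restriction: a member is
  the class of all functions that agree near \<open>0\<close> with a function from one of the spaces.\<close>

definition E0_Roumieu :: "(real \<Rightarrow> real) \<Rightarrow> (real \<Rightarrow> complex) set set" where
  "E0_Roumieu \<omega> = (\<Union>k\<in>{1::nat..}. germ0 ` E_Roumieu \<omega> {- (1 / real k) <..< 1 / real k})"

definition E0_Beurling :: "(real \<Rightarrow> real) \<Rightarrow> (real \<Rightarrow> complex) set set" where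
  "E0_Beurling \<omega> = (\<Union>k\<in>{1::nat..}. germ0 ` E_Beurling \<omega> {- (1 / real k) <..< 1 / real k})"

definition taylor_series0 :: "(real \<Rightarrow> complex) \<Rightarrow> complex fps" where
  "taylor_series0 f = Abs_fps (\<lambda>j. nth_deriv j f 0 / fact j)"

text \<open>The Borel map on germs, evaluated on an arbitrary representative (see \<open>borel_map_germ0\<close>).\<close>

definition borel_map :: "(real \<Rightarrow> complex) set \<Rightarrow> complex fps" where
  "borel_map G = (THE F. \<exists>f\<in>G. F = taylor_series0 f)"


section \<open>Spaces of formal power series\<close>

definition coeff_bound :: "(real \<Rightarrow> real) \<Rightarrow> real \<Rightarrow> complex fps \<Rightarrow> bool" where
  "coeff_bound \<omega> l F \<longleftrightarrow>
     bdd_above (range (\<lambda>j. norm (fps_nth F j) * fact j / weight_seq \<omega> l j))"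

definition F_Roumieu :: "(real \<Rightarrow> real) \<Rightarrow> complex fps set" where
  "F_Roumieu \<omega> = {F. \<exists>l>0. coeff_bound \<omega> l F}"

definition F_Beurling :: "(real \<Rightarrow> real) \<Rightarrow> complex fps set" where
  "F_Beurling \<omega> = {F. \<forall>l>0. coeff_bound \<omega> l F}"


section \<open>Algebrability\<close>

text \<open>All algebras are complex algebras of formal power series, not necessarily unital; the
  multiplication of \<^typ>\<open>complex fps\<close> is the Cauchy product.\<close>

definition fps_algebra :: "complex fps set \<Rightarrow> bool" where
  "fps_algebra A \<longleftrightarrow> 0 \<in> A \<and> (\<forall>F\<in>A. \<forall>G\<in>A. F + G \<in> A) \<and>
     (\<forall>c. \<forall>F\<in>A. fps_const c * F \<in> A) \<and> (\<forall>F\<in>A. \<forall>G\<in>A. F * G \<in> A)"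

definition minimal_generators :: "complex fps set \<Rightarrow> complex fps set \<Rightarrow> bool" where
  "minimal_generators S C \<longleftrightarrow>
     fps_algebra hull S = C \<and> (\<forall>T. T \<subset> S \<longrightarrow> fps_algebra hull T \<noteq> C)"

text \<open>The cardinal \<open>\<kappa>\<close> is given by a set \<open>I\<close> of that cardinality.\<close>

definition generated_by_card :: "'k set \<Rightarrow> complex fps set \<Rightarrow> bool" where
  "generated_by_card I C \<longleftrightarrow> (\<exists>S. S \<approx> I \<and> minimal_generators S C)"

definition algebrable_in :: "'k set \<Rightarrow> complex fps set \<Rightarrow> complex fps set \<Rightarrow> bool" where
  "algebrable_in I A B \<longleftrightarrow> fps_algebra A \<and> B \<subseteq> A \<and>
     (\<exists>C. fps_algebra C \<and> C \<subseteq> A \<and> generated_by_card I C \<and> C \<subseteq> B \<union> {0})"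


section \<open>Basic facts showing that the definitions make sense\<close>

lemma nth_deriv_cong_ev:
  assumes "\<forall>\<^sub>F x in nhds a. g x = f x"
  shows "\<forall>\<^sub>F x in nhds a. nth_deriv j g x = nth_deriv j f x"
proof (induction j)
  case 0
  then show ?case using assms by (simp add: nth_deriv_def)
next
  case (Suc j)
  have "\<forall>\<^sub>F x in nhds a. \<forall>\<^sub>F y in nhds x. nth_deriv j g y = nth_deriv j f y"
    using Suc by (simp add: eventually_eventually)
  then show ?case
  proof eventually_elim
    case (elim x)
    have "vector_derivative (nth_deriv j g) (at x) = vector_derivative (nth_deriv j f) (at x)"
      using elim by (intro vector_derivative_cong_eq) auto
    then show ?case by (simp add: nth_deriv_def)
  qed
qed

lemma borel_map_germ0: "borel_map (germ0 f) = taylor_series0 f"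
proof -
  have "taylor_series0 g = taylor_series0 f" if "g \<in> germ0 f" for g
  proof -
    have "nth_deriv j g 0 = nth_deriv j f 0" for j
      using nth_deriv_cong_ev[of g f 0 j] that
      by (auto simp: germ0_def dest: eventually_nhds_x_imp_x)
    then show ?thesis by (simp add: taylor_series0_def)
  qed
  moreover have "f \<in> germ0 f" by (simp add: germ0_def)
  ultimately show ?thesis unfolding borel_map_def by (intro the_equality) blast+
qed

lemma phi_nonneg: "\<omega> \<in> weight_class \<Longrightarrow> 0 \<le> phi \<omega> y"
  by (simp add: weight_class_def weight_function_def phi_def)

lemma phi_star_bdd:
  assumes "\<omega> \<in> weight_class"
  shows "bdd_above ((\<lambda>y. x * y - phi \<omega> y) ` {0..})"
proof -
  have "ln \<in> o[at_top](\<omega>)" using assms by (simp add: weight_class_def)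
  then have "\<forall>\<^sub>F t in at_top. norm (ln t) \<le> 1 / (\<bar>x\<bar> + 1) * norm (\<omega> t)"
    by (rule landau_o.smallD) simp
  then obtain T where T: "\<And>t. t \<ge> T \<Longrightarrow> \<bar>ln t\<bar> \<le> 1 / (\<bar>x\<bar> + 1) * \<bar>\<omega> t\<bar>"
    by (auto simp: eventually_at_top_linorder)
  have "x * y - phi \<omega> y \<le> \<bar>x\<bar> * \<bar>T\<bar>" if y: "y \<ge> 0" for y
  proof (cases "exp y \<ge> T")
    case True
    have "\<bar>y\<bar> \<le> 1 / (\<bar>x\<bar> + 1) * phi \<omega> y"
      using T[OF True] phi_nonneg[OF assms, of y] by (simp add: phi_def)
    then have "(\<bar>x\<bar> + 1) * y \<le> phi \<omega> y" using y by (simp add: field_simps)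
    moreover have "x * y \<le> (\<bar>x\<bar> + 1) * y" using y by (intro mult_right_mono) auto
    ultimately have "x * y - phi \<omega> y \<le> 0" by linarith
    also have "0 \<le> \<bar>x\<bar> * \<bar>T\<bar>" by simp
    finally show ?thesis .
  next
    case False
    have "y \<le> \<bar>T\<bar>" using False exp_ge_add_one_self[of y] by linarith
    then have "\<bar>x\<bar> * y \<le> \<bar>x\<bar> * \<bar>T\<bar>" by (intro mult_left_mono) auto
    moreover have "x * y \<le> \<bar>x\<bar> * y" using y by (intro mult_right_mono) auto
    ultimately show ?thesis using phi_nonneg[OF assms, of y] by linarith
  qed
  then show ?thesis by (intro bdd_aboveI2) auto
qed

lemma phi_star_upper:
  "\<omega> \<in> weight_class \<Longrightarrow> 0 \<le> y \<Longrightarrow> x * y - phi \<omega> y \<le> phi_star \<omega> x"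
  unfolding phi_star_def by (rule cSUP_upper[OF _ phi_star_bdd]) auto

lemma phi_star_least: "(\<And>y. 0 \<le> y \<Longrightarrow> x * y - phi \<omega> y \<le> B) \<Longrightarrow> phi_star \<omega> x \<le> B"
  unfolding phi_star_def by (rule cSUP_least) auto

lemma phi_star_scale:
  assumes "\<omega> \<in> weight_class" "0 \<le> t" "t \<le> 1"
  shows "phi_star \<omega> (t * x) \<le> t * phi_star \<omega> x"
proof (rule phi_star_least)
  fix y :: real assume y: "0 \<le> y"
  have "t * (x * y - phi \<omega> y) \<le> t * phi_star \<omega> x"
    using phi_star_upper[OF assms(1) y] assms(2) by (rule mult_left_mono)
  moreover have "t * phi \<omega> y \<le> 1 * phi \<omega> y"
    using assms(3) phi_nonneg[OF assms(1)] by (rule mult_right_mono)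
  ultimately show "t * x * y - phi \<omega> y \<le> t * phi_star \<omega> x"
    by (simp add: algebra_simps)
qed

lemma phi_star_superadd:
  assumes "\<omega> \<in> weight_class" "0 \<le> x" "0 \<le> y"
  shows "phi_star \<omega> x + phi_star \<omega> y \<le> phi_star \<omega> (x + y)"
proof (cases "x + y = 0")
  case True
  then have [simp]: "x = 0" "y = 0" using assms by auto
  show ?thesis using phi_star_scale[OF assms(1), of 0 0] by simp
next
  case False
  have "phi_star \<omega> (x / (x + y) * (x + y)) \<le> x / (x + y) * phi_star \<omega> (x + y)"
    and "phi_star \<omega> (y / (x + y) * (x + y)) \<le> y / (x + y) * phi_star \<omega> (x + y)"
    using assms False by (intro phi_star_scale; simp add: divide_le_eq)+
  then have "phi_star \<omega> x + phi_star \<omega> y \<le>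
      x / (x + y) * phi_star \<omega> (x + y) + y / (x + y) * phi_star \<omega> (x + y)"
    using False by simp
  also have "\<dots> = (x / (x + y) + y / (x + y)) * phi_star \<omega> (x + y)"
    by (rule distrib_right[symmetric])
  also have "x / (x + y) + y / (x + y) = 1"
    using False by (simp flip: add_divide_distrib)
  finally show ?thesis by simp
qed

lemma weight_seq_pos: "0 < weight_seq \<omega> l j"
  by (simp add: weight_seq_def)

lemma weight_seq_mult:
  assumes "\<omega> \<in> weight_class" "0 < l"
  shows "weight_seq \<omega> l i * weight_seq \<omega> l k \<le> weight_seq \<omega> l (i + k)"
proof -
  have "phi_star \<omega> (l * real i) + phi_star \<omega> (l * real k) \<le> phi_star \<omega> (l * real (i + k))"
    using phi_star_superadd[OF assms(1), of "l * real i" "l * real k"] assms(2)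
    by (simp add: distrib_left)
  then show ?thesis
    using assms(2) unfolding weight_seq_def mult_exp_exp exp_le_cancel_iff
    by (simp add: divide_right_mono flip: add_divide_distrib)
qed

lemma weight_seq_mono:
  assumes "\<omega> \<in> weight_class" "0 < l" "l \<le> m"
  shows "weight_seq \<omega> l j \<le> weight_seq \<omega> m j"
proof -
  have "phi_star \<omega> (l / m * (m * real j)) \<le> l / m * phi_star \<omega> (m * real j)"
    using assms by (intro phi_star_scale) auto
  then have "phi_star \<omega> (l * real j) / l \<le> phi_star \<omega> (m * real j) / m"
    using assms by (simp add: field_simps)
  then show ?thesis by (simp add: weight_seq_def)
qed

lemma weight_seq_absorb:
  assumes "\<omega> \<in> weight_class"
  obtains L where "L \<ge> 1"
    "\<And>l. 0 < l \<Longrightarrow> \<exists>C>0. \<forall>j. 2 ^ j * weight_seq \<omega> l j \<le> C * weight_seq \<omega> (L * l) j"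
proof -
  have wf: "weight_function \<omega>" and "(\<lambda>t. \<omega> (2 * t)) \<in> O[at_top](\<omega>)"
    using assms by (auto simp: weight_class_def)
  then obtain c where "\<forall>\<^sub>F t in at_top. norm (\<omega> (2 * t)) \<le> c * norm (\<omega> t)"
    by (auto elim: landau_o.bigE)
  then obtain T where T: "\<And>t. t \<ge> T \<Longrightarrow> \<bar>\<omega> (2 * t)\<bar> \<le> c * \<bar>\<omega> t\<bar>"
    by (auto simp: eventually_at_top_linorder)
  have nn: "0 \<le> \<omega> t" if "0 \<le> t" for t using wf that by (simp add: weight_function_def)
  define L where "L = max 1 (max c (\<omega> (2 * \<bar>T\<bar>)))"
  have L1: "L \<ge> 1" and Lc: "L \<ge> c" and LT: "L \<ge> \<omega> (2 * \<bar>T\<bar>)" by (auto simp: L_def)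
  have key: "\<omega> (2 * t) \<le> L * \<omega> t + L" if t: "0 \<le> t" for t
  proof (cases "t \<ge> T")
    case True
    have "\<omega> (2 * t) \<le> c * \<omega> t" using T[OF True] nn[of t] nn[of "2 * t"] t by simp
    also have "\<dots> \<le> L * \<omega> t" using Lc nn[OF t] by (rule mult_right_mono)
    finally show ?thesis using L1 by linarith
  next
    case False
    have "mono_on {0..} \<omega>" using wf by (simp add: weight_function_def)
    then have "\<omega> (2 * t) \<le> \<omega> (2 * \<bar>T\<bar>)" by (rule mono_onD) (use False t in auto)
    moreover have "0 \<le> L * \<omega> t" using L1 nn[OF t] by simp
    ultimately show ?thesis using LT by linarith
  qed
  have phi2: "phi \<omega> (y + ln 2) \<le> L * phi \<omega> y + L" for y
    using key[of "exp y"] by (simp add: phi_def exp_add mult.commute)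
  have star: "L * phi_star \<omega> x + L * x * ln 2 - L \<le> phi_star \<omega> (L * x)" for x
  proof -
    have "phi_star \<omega> x \<le> (phi_star \<omega> (L * x) - L * x * ln 2 + L) / L"
    proof (rule phi_star_least)
      fix y :: real assume "0 \<le> y"
      then have "L * x * (y + ln 2) - phi \<omega> (y + ln 2) \<le> phi_star \<omega> (L * x)"
        by (intro phi_star_upper[OF assms]) simp
      then have "L * (x * y - phi \<omega> y) \<le> phi_star \<omega> (L * x) - L * x * ln 2 + L"
        using phi2[of y] by (simp add: algebra_simps)
      then show "x * y - phi \<omega> y \<le> (phi_star \<omega> (L * x) - L * x * ln 2 + L) / L"
        using L1 by (simp add: pos_le_divide_eq mult.commute)
    qed
    then show ?thesis using L1 by (simp add: pos_le_divide_eq mult.commute mult.left_commute)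
  qed
  have "\<exists>C>0. \<forall>j. 2 ^ j * weight_seq \<omega> l j \<le> C * weight_seq \<omega> (L * l) j" if l: "0 < l" for l
  proof (intro exI conjI allI)
    show "0 < exp (1 / l)" by simp
    fix j
    have "L * phi_star \<omega> (l * real j) + L * (l * real j) * ln 2 - L \<le> phi_star \<omega> (L * (l * real j))"
      by (rule star)
    then have "(L * phi_star \<omega> (l * real j) + L * (l * real j) * ln 2 - L) / (L * l)
        \<le> phi_star \<omega> (L * (l * real j)) / (L * l)"
      using L1 l by (intro divide_right_mono) auto
    moreover have "(L * phi_star \<omega> (l * real j) + L * (l * real j) * ln 2 - L) / (L * l)
        = phi_star \<omega> (l * real j) / l + real j * ln 2 - 1 / l"
      using L1 l by (simp add: field_simps)
    ultimately have "real j * ln 2 + 1 / l * phi_star \<omega> (l * real j)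
        \<le> 1 / l + 1 / (L * l) * phi_star \<omega> (L * l * real j)"
      by (simp add: mult.assoc)
    then have "exp (real j * ln 2) * weight_seq \<omega> l j \<le> exp (1 / l) * weight_seq \<omega> (L * l) j"
      unfolding weight_seq_def mult_exp_exp exp_le_cancel_iff .
    then show "2 ^ j * weight_seq \<omega> l j \<le> exp (1 / l) * weight_seq \<omega> (L * l) j"
      by (simp add: exp_of_nat_mult)
  qed
  with L1 show ?thesis by (rule that)
qed

lemma coeff_bound_iff:
  "coeff_bound \<omega> l F \<longleftrightarrow> (\<exists>M\<ge>0. \<forall>j. norm (fps_nth F j) * fact j \<le> M * weight_seq \<omega> l j)"
proof
  assume "coeff_bound \<omega> l F"
  then obtain M where M: "\<And>j. norm (fps_nth F j) * fact j / weight_seq \<omega> l j \<le> M"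
    by (auto simp: coeff_bound_def bdd_above_def)
  have "0 \<le> norm (fps_nth F 0) * fact 0 / weight_seq \<omega> l 0"
    using weight_seq_pos[of \<omega> l 0] by simp
  with M[of 0] have "0 \<le> M" by linarith
  with M show "\<exists>M\<ge>0. \<forall>j. norm (fps_nth F j) * fact j \<le> M * weight_seq \<omega> l j"
    by (auto simp: pos_divide_le_eq[OF weight_seq_pos])
next
  assume "\<exists>M\<ge>0. \<forall>j. norm (fps_nth F j) * fact j \<le> M * weight_seq \<omega> l j"
  then obtain M where "\<And>j. norm (fps_nth F j) * fact j \<le> M * weight_seq \<omega> l j" by auto
  then show "coeff_bound \<omega> l F"
    unfolding coeff_bound_def by (intro bdd_aboveI2) (auto simp: pos_divide_le_eq[OF weight_seq_pos])
qed

lemma coeff_bound_mono: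
  assumes "\<omega> \<in> weight_class" "0 < l" "l \<le> m" "coeff_bound \<omega> l F"
  shows "coeff_bound \<omega> m F"
proof -
  obtain M where M: "M \<ge> 0" "\<And>j. norm (fps_nth F j) * fact j \<le> M * weight_seq \<omega> l j"
    using assms(4) by (auto simp: coeff_bound_iff)
  have "norm (fps_nth F j) * fact j \<le> M * weight_seq \<omega> m j" for j
    using M(2)[of j] mult_left_mono[OF weight_seq_mono[OF assms(1-3), of j] M(1)] by linarith
  with M(1) show ?thesis by (auto simp: coeff_bound_iff)
qed

lemma coeff_bound_zero: "coeff_bound \<omega> l 0"
  by (auto simp: coeff_bound_iff)

lemma coeff_bound_add:
  assumes "coeff_bound \<omega> l F" "coeff_bound \<omega> l G"
  shows "coeff_bound \<omega> l (F + G)"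
proof -
  obtain M N where M: "M \<ge> 0" "\<And>j. norm (fps_nth F j) * fact j \<le> M * weight_seq \<omega> l j"
    and N: "N \<ge> 0" "\<And>j. norm (fps_nth G j) * fact j \<le> N * weight_seq \<omega> l j"
    using assms by (auto simp: coeff_bound_iff)
  have "norm (fps_nth (F + G) j) * fact j \<le> (M + N) * weight_seq \<omega> l j" for j
  proof -
    have "norm (fps_nth (F + G) j) * fact j \<le> (norm (fps_nth F j) + norm (fps_nth G j)) * fact j"
      by (intro mult_right_mono) (auto simp: norm_triangle_ineq)
    then show ?thesis using M(2)[of j] N(2)[of j] by (simp add: distrib_right)
  qed
  then show ?thesis using M(1) N(1) unfolding coeff_bound_iff by (intro exI[of _ "M + N"]) auto
qed

lemma coeff_bound_scale:
  assumes "coeff_bound \<omega> l F"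
  shows "coeff_bound \<omega> l (fps_const c * F)"
proof -
  obtain M where M: "M \<ge> 0" "\<And>j. norm (fps_nth F j) * fact j \<le> M * weight_seq \<omega> l j"
    using assms by (auto simp: coeff_bound_iff)
  have "norm (fps_nth (fps_const c * F) j) * fact j \<le> (norm c * M) * weight_seq \<omega> l j" for j
    using mult_left_mono[OF M(2)[of j], of "norm c"] by (simp add: norm_mult mult.assoc)
  then show ?thesis using M(1) unfolding coeff_bound_iff by (intro exI[of _ "norm c * M"]) auto
qed

lemma coeff_bound_mult:
  assumes W: "\<omega> \<in> weight_class" and l: "0 < l"
    and C: "C > 0" "\<And>j. 2 ^ j * weight_seq \<omega> l j \<le> C * weight_seq \<omega> m j"
    and FG: "coeff_bound \<omega> l F" "coeff_bound \<omega> l G"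
  shows "coeff_bound \<omega> m (F * G)"
proof -
  obtain M N where M: "M \<ge> 0" "\<And>j. norm (fps_nth F j) * fact j \<le> M * weight_seq \<omega> l j"
    and N: "N \<ge> 0" "\<And>j. norm (fps_nth G j) * fact j \<le> N * weight_seq \<omega> l j"
    using FG by (auto simp: coeff_bound_iff)
  have "norm (fps_nth (F * G) j) * fact j \<le> (M * N * C) * weight_seq \<omega> m j" for j
  proof -
    have "norm (fps_nth (F * G) j) * fact j
        \<le> (\<Sum>r=0..j. norm (fps_nth F r) * norm (fps_nth G (j - r))) * fact j"
      unfolding fps_mult_nth
      by (intro mult_right_mono sum_norm_le) (auto simp: norm_mult)
    also have "\<dots> = (\<Sum>r=0..j. real (j choose r) *
        ((norm (fps_nth F r) * fact r) * (norm (fps_nth G (j - r)) * fact (j - r))))"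
      unfolding sum_distrib_right by (intro sum.cong) (auto simp: binomial_fact)
    also have "\<dots> \<le> (\<Sum>r=0..j. real (j choose r) * (M * N * weight_seq \<omega> l j))"
    proof (intro sum_mono mult_left_mono)
      fix r assume "r \<in> {0..j}"
      then have r: "r + (j - r) = j" by simp
      have "(norm (fps_nth F r) * fact r) * (norm (fps_nth G (j - r)) * fact (j - r))
          \<le> (M * weight_seq \<omega> l r) * (N * weight_seq \<omega> l (j - r))"
        using M(1) less_imp_le[OF weight_seq_pos[of \<omega> l r]]
        by (intro mult_mono[OF M(2) N(2)]) auto
      also have "\<dots> = M * N * (weight_seq \<omega> l r * weight_seq \<omega> l (j - r))" by simp
      also have "\<dots> \<le> M * N * weight_seq \<omega> l j"
        using weight_seq_mult[OF W l, of r "j - r"] M(1) N(1) unfolding r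
        by (intro mult_left_mono) auto
      finally show "(norm (fps_nth F r) * fact r) * (norm (fps_nth G (j - r)) * fact (j - r))
          \<le> M * N * weight_seq \<omega> l j" .
    qed auto
    also have "\<dots> = M * N * (2 ^ j * weight_seq \<omega> l j)"
    proof -
      have "(\<Sum>r=0..j. real (j choose r)) = 2 ^ j"
        using choose_row_sum[of j] by (simp add: atMost_atLeast0 flip: of_nat_sum)
      then show ?thesis by (simp flip: sum_distrib_right)
    qed
    also have "\<dots> \<le> M * N * (C * weight_seq \<omega> m j)"
      using C(2)[of j] M(1) N(1) by (intro mult_left_mono) auto
    finally show ?thesis by (simp add: mult.assoc)
  qed
  then show ?thesis
    using M(1) N(1) C(1) unfolding coeff_bound_iff by (intro exI[of _ "M * N * C"]) auto
qed

lemma fps_algebra_F_Roumieu: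
  assumes W: "\<omega> \<in> weight_class"
  shows "fps_algebra (F_Roumieu \<omega>)"
proof -
  obtain L where L: "L \<ge> 1"
    "\<And>l. 0 < l \<Longrightarrow> \<exists>C>0. \<forall>j. 2 ^ j * weight_seq \<omega> l j \<le> C * weight_seq \<omega> (L * l) j"
    using weight_seq_absorb[OF W] by blast
  have common: "\<exists>l>0. coeff_bound \<omega> l F \<and> coeff_bound \<omega> l G"
    if FG: "F \<in> F_Roumieu \<omega>" "G \<in> F_Roumieu \<omega>" for F G
  proof -
    obtain a b where ab: "a > 0" "coeff_bound \<omega> a F" "b > 0" "coeff_bound \<omega> b G"
      using FG by (auto simp: F_Roumieu_def)
    have "coeff_bound \<omega> (max a b) F" "coeff_bound \<omega> (max a b) G"
      using coeff_bound_mono[OF W ab(1) max.cobounded1 ab(2)]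
        coeff_bound_mono[OF W ab(3) max.cobounded2 ab(4)] by auto
    then show ?thesis using ab(1) by (intro exI[of _ "max a b"]) auto
  qed
  have "F * G \<in> F_Roumieu \<omega>" if FG: "F \<in> F_Roumieu \<omega>" "G \<in> F_Roumieu \<omega>" for F G
  proof -
    obtain l where l: "l > 0" "coeff_bound \<omega> l F" "coeff_bound \<omega> l G"
      using common[OF FG] by blast
    obtain C where C: "C > 0" "\<And>j. 2 ^ j * weight_seq \<omega> l j \<le> C * weight_seq \<omega> (L * l) j"
      using L(2)[OF l(1)] by blast
    have "coeff_bound \<omega> (L * l) (F * G)"
      by (rule coeff_bound_mult[OF W l(1) C l(2,3)])
    moreover have "L * l > 0" using L(1) l(1) by simp
    ultimately show ?thesis unfolding F_Roumieu_def by blast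
  qed
  moreover have "F + G \<in> F_Roumieu \<omega>" if "F \<in> F_Roumieu \<omega>" "G \<in> F_Roumieu \<omega>" for F G
    using common[OF that] coeff_bound_add unfolding F_Roumieu_def by blast
  moreover have "fps_const c * F \<in> F_Roumieu \<omega>" if "F \<in> F_Roumieu \<omega>" for c F
    using that coeff_bound_scale unfolding F_Roumieu_def by blast
  moreover have "0 \<in> F_Roumieu \<omega>"
    using coeff_bound_zero[of \<omega> 1] zero_less_one unfolding F_Roumieu_def by blast
  ultimately show ?thesis unfolding fps_algebra_def by blast
qed

lemma fps_algebra_F_Beurling:
  assumes W: "\<omega> \<in> weight_class"
  shows "fps_algebra (F_Beurling \<omega>)"
proof -
  obtain L where L: "L \<ge> 1"
    "\<And>l. 0 < l \<Longrightarrow> \<exists>C>0. \<forall>j. 2 ^ j * weight_seq \<omega> l j \<le> C * weight_seq \<omega> (L * l) j"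
    using weight_seq_absorb[OF W] by blast
  have "coeff_bound \<omega> l (F * G)"
    if FG: "F \<in> F_Beurling \<omega>" "G \<in> F_Beurling \<omega>" and l: "l > 0" for F G l
  proof -
    have l': "l / L > 0" and eq: "L * (l / L) = l" using L(1) l by auto
    obtain C where C: "C > 0" "\<And>j. 2 ^ j * weight_seq \<omega> (l / L) j \<le> C * weight_seq \<omega> l j"
      using L(2)[OF l'] unfolding eq by blast
    have "coeff_bound \<omega> (l / L) F" "coeff_bound \<omega> (l / L) G"
      using FG l' unfolding F_Beurling_def by blast+
    then show ?thesis by (rule coeff_bound_mult[OF W l' C])
  qed
  then have "F * G \<in> F_Beurling \<omega>" if "F \<in> F_Beurling \<omega>" "G \<in> F_Beurling \<omega>" for F G
    using that unfolding F_Beurling_def by blast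
  moreover have "F + G \<in> F_Beurling \<omega>" if "F \<in> F_Beurling \<omega>" "G \<in> F_Beurling \<omega>" for F G
    using that coeff_bound_add unfolding F_Beurling_def by blast
  moreover have "fps_const c * F \<in> F_Beurling \<omega>" if "F \<in> F_Beurling \<omega>" for c F
    using that coeff_bound_scale unfolding F_Beurling_def by blast
  moreover have "0 \<in> F_Beurling \<omega>"
    using coeff_bound_zero unfolding F_Beurling_def by blast
  ultimately show ?thesis unfolding fps_algebra_def by blast
qed

end

theory Submission
  imports Defs
begin

text \<open>Bang's argument shows that a function of a quasianalytic class whose Taylor coefficients at
  \<open>0\<close> vanish on a sufficiently long range of orders is uniformly close, on a fixed interval, to its
  Taylor polynomial before that range; hence the last coefficient before the gap grows at most
  geometrically in its order. The generators are power series
  \<open>\<Sum>k. k ^ n k * u k \<alpha> * x ^ n k\<close> with \<open>\<alpha>\<close> real, with exponents \<open>n k\<close> growing so fast that every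
  polynomial in the generators has such gaps, and with numbers \<open>u k \<alpha>\<close> that take any prescribed
  finite pattern of values for infinitely many \<open>k\<close>. The last coefficient of a polynomial of degree
  \<open>d\<close> before the gap that ends at \<open>n (k + 1)\<close> has order \<open>d * n k\<close> and is \<open>k ^ (d * n k)\<close> times the value of
  the leading form at the \<open>u k \<alpha>\<close>, which is a fixed nonzero number for infinitely many \<open>k\<close>, so it
  grows faster than geometrically. This excludes every nonzero element of the algebra from the image
  of the Borel map, and excludes algebraic relations between the generators.\<close>

section \<open>Bang's estimate\<close>

text \<open>The integral form of the remainder, with the norm taken under the integral; the mean
  value form fails for vector values, in particular for complex ones.\<close>

lemma Taylor_remainder_norm:
  fixes Df :: "nat \<Rightarrow> real \<Rightarrow> 'a::banach"
  assumes p: "p > 0" and ab: "a \<le> b"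
    and Df: "\<And>m t. m < p \<Longrightarrow> t \<in> {a..b} \<Longrightarrow>
      (Df m has_vector_derivative Df (Suc m) t) (at t within {a..b})"
    and B: "\<And>t. t \<in> {a..b} \<Longrightarrow> norm (Df p t) \<le> B"
  shows "norm (Df 0 b - (\<Sum>i<p. ((b - a) ^ i / fact i) *\<^sub>R Df i a)) \<le> (b - a) ^ p / fact p * B"
proof -
  have pw: "((\<lambda>x. (b - x) ^ (p - 1) / fact (p - 1) * B) has_integral (b - a) ^ p / fact p * B) {a..b}"
  proof -
    have fp: "(fact p :: real) = real p * fact (p - 1)"
      using p by (simp add: fact_reduce)
    define F where "F x = - ((b - x) ^ p / fact p * B)" for x
    have "((\<lambda>x. (b - x) ^ (p - 1) / fact (p - 1) * B) has_integral (F b - F a)) {a..b}"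
      using ab
    proof (rule fundamental_theorem_of_calculus)
      fix x
      have "(F has_real_derivative (b - x) ^ (p - 1) / fact (p - 1) * B) (at x within {a..b})"
        unfolding F_def using p by (auto intro!: derivative_eq_intros simp: fp)
      then show "(F has_vector_derivative (b - x) ^ (p - 1) / fact (p - 1) * B) (at x within {a..b})"
        by (rule has_real_derivative_iff_has_vector_derivative[THEN iffD1])
    qed
    then show ?thesis using p by (simp add: F_def power_0_left)
  qed
  define g where "g = (\<lambda>x. ((b - x) ^ (p - 1) / fact (p - 1)) *\<^sub>R Df p x)"
  have g: "(g has_integral Df 0 b - (\<Sum>i<p. ((b - a) ^ i / fact i) *\<^sub>R Df i a)) {a..b}"
    unfolding g_def using p ab Df by (intro Taylor_has_integral) auto
  have "norm (integral {a..b} g) \<le> integral {a..b} (\<lambda>x. (b - x) ^ (p - 1) / fact (p - 1) * B)"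
  proof (rule integral_norm_bound_integral)
    fix x assume x: "x \<in> {a..b}"
    then have "(b - x) ^ (p - 1) / fact (p - 1) \<ge> 0" by auto
    moreover from this have "norm (g x) = (b - x) ^ (p - 1) / fact (p - 1) * norm (Df p x)"
      unfolding g_def norm_scaleR real_norm_def by (simp only: abs_of_nonneg)
    ultimately show "norm (g x) \<le> (b - x) ^ (p - 1) / fact (p - 1) * B"
      using B[OF x] by (simp only: mult_left_mono)
  qed (use g pw in auto)
  then show ?thesis
    unfolding integral_unique[OF g] integral_unique[OF pw] .
qed

text \<open>A product of \<open>i\<close> successive quotients starting at \<open>j\<close>, each at
  most the quotient at \<open>N\<close>; \<open>j + i \<le> Suc N\<close> keeps all their indices at
  most \<open>N\<close>.\<close>

lemma quotient_mono_imp_power_bound: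
  fixes M :: "nat \<Rightarrow> real"
  assumes pos: "\<And>j. M j > 0"
    and lc: "\<And>i k. i \<le> k \<Longrightarrow> M (Suc i) / M i \<le> M (Suc k) / M k"
    and "j + i \<le> Suc N"
  shows "M (j + i) \<le> M j * (M (Suc N) / M N) ^ i"
  using assms(3)
proof (induction i)
  case (Suc i)
  have q: "M (Suc N) / M N \<ge> 0" using pos by (simp add: less_imp_le)
  have "M (j + Suc i) = M (j + i) * (M (Suc (j + i)) / M (j + i))"
    using pos[of "j + i"] by simp
  also have "\<dots> \<le> M (j + i) * (M (Suc N) / M N)"
    using Suc.prems pos[of "j + i"] by (intro mult_left_mono lc) auto
  also have "\<dots> \<le> M j * (M (Suc N) / M N) ^ i * (M (Suc N) / M N)"
    using Suc q by (intro mult_right_mono) auto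
  finally show ?case by (simp add: mult_ac)
qed simp

lemma sum_power_fact_le_exp:
  assumes "0 \<le> (x::real)"
  shows "(\<Sum>i<n. x ^ i / fact i) \<le> exp x"
proof -
  have s: "(\<lambda>i. x ^ i / fact i) sums exp x"
    using exp_converges[of x] by (simp add: scaleR_conv_of_real field_simps)
  then show ?thesis
    using sum_le_suminf[of "\<lambda>i. x ^ i / fact i" "{..<n}"] assms
    by (auto simp: sums_iff)
qed

lemma exp_times_exp_one_power: "exp x * exp 1 ^ n = exp (x + real n)" for x :: real
  by (metis exp_add exp_of_nat_mult mult.right_neutral)

text \<open>A move to the right by at most \<open>M N / (exp 1 * M (Suc N))\<close> costs one factor
  e. With \<open>A\<close> the bound assumed for \<open>Df j a\<close>, the i-th Taylor term is at
  most \<open>A * ((exp 1 * (b - a) * q) ^ i / fact i)\<close>, and so is the remainder for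
  \<open>i = p\<close>; hence the total is at most \<open>A * exp 1\<close>.\<close>

lemma Bang_step:
  fixes Df :: "nat \<Rightarrow> real \<Rightarrow> 'a::banach" and M :: "nat \<Rightarrow> real"
  assumes pos: "\<And>j. M j > 0"
    and lc: "\<And>i k. i \<le> k \<Longrightarrow> M (Suc i) / M i \<le> M (Suc k) / M k"
    and ab: "a \<le> b" and C: "C \<ge> 0"
    and Df: "\<And>m t. t \<in> {a..b} \<Longrightarrow>
      (Df m has_vector_derivative Df (Suc m) t) (at t within {a..b})"
    and bd: "\<And>j t. t \<in> {a..b} \<Longrightarrow> norm (Df j t) \<le> C * M j"
    and small: "\<And>j. j \<ge> K \<Longrightarrow> norm (Df j a) \<le> C * exp (real j - real (Suc N)) * M j"
    and h: "(b - a) * exp 1 \<le> M N / M (Suc N)"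
    and jK: "j \<ge> K"
  shows "norm (Df j b) \<le> C * exp (real j - real N) * M j"
proof (cases "j \<le> N")
  case False
  then have "C * M j * 1 \<le> C * M j * exp (real j - real N)"
    using C less_imp_le[OF pos[of j]] by (intro mult_left_mono) auto
  then show ?thesis using bd[of b j] ab by (simp add: mult_ac)
next
  case True
  \<comment> \<open>The remainder involves \<open>Df (Suc N)\<close>, for which the exponential in
    \<open>small\<close> would equal 1, so the a priori bound \<open>bd\<close> has the same shape
    as the bounds of the other terms.\<close>
  define p where "p = Suc N - j"
  define q where "q = M (Suc N) / M N"
  define A where "A = C * exp (real j - real (Suc N)) * M j"
  have p0: "p > 0" and pj: "j + p = Suc N" using True by (auto simp: p_def)
  have q: "q \<ge> 0" using pos by (simp add: q_def less_imp_le)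
  have A: "A \<ge> 0" using pos C by (simp add: A_def less_imp_le)
  have hq: "exp 1 * (b - a) * q \<le> 1"
  proof -
    have "(b - a) * exp 1 * q \<le> M N / M (Suc N) * q"
      using h q by (rule mult_right_mono)
    also have "\<dots> = 1" using pos[of N] pos[of "Suc N"] by (simp add: q_def)
    finally show ?thesis by (simp only: mult_ac)
  qed
  have Mi: "M (j + i) \<le> M j * q ^ i" if "i \<le> p" for i
    unfolding q_def using that pj by (intro quotient_mono_imp_power_bound pos lc) auto
  have "norm (Df j b - (\<Sum>i<p. ((b - a) ^ i / fact i) *\<^sub>R Df (j + i) a)) \<le>
      (b - a) ^ p / fact p * (C * M (Suc N))"
  proof -
    have "norm (Df (j + 0) b - (\<Sum>i<p. ((b - a) ^ i / fact i) *\<^sub>R Df (j + i) a)) \<le>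
        (b - a) ^ p / fact p * (C * M (Suc N))"
    proof (rule Taylor_remainder_norm[OF p0 ab])
      fix m t assume "t \<in> {a..b}"
      then show "(Df (j + m) has_vector_derivative Df (j + Suc m) t) (at t within {a..b})"
        using Df[of t "j + m"] by simp
    next
      fix t assume "t \<in> {a..b}"
      then show "norm (Df (j + p) t) \<le> C * M (Suc N)"
        unfolding pj by (rule bd)
    qed
    then show ?thesis by simp
  qed
  also have "\<dots> \<le> (b - a) ^ p / fact p * (A * (exp 1 * q) ^ p)"
  proof (intro mult_left_mono)
    have "C * M (Suc N) \<le> C * (M j * q ^ p)"
      using Mi[of p] pj C by (intro mult_left_mono) auto
    also have "\<dots> = A * (exp 1 * q) ^ p"
    proof -
      have "exp (real j - real (Suc N)) * exp 1 ^ p = exp (real j - real (Suc N) + real p)"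
        by (rule exp_times_exp_one_power)
      also have "real j - real (Suc N) + real p = 0" using pj by linarith
      finally have one: "exp (real j - real (Suc N)) * exp 1 ^ p = 1" by simp
      have "A * (exp 1 * q) ^ p = C * (M j * q ^ p) * (exp (real j - real (Suc N)) * exp 1 ^ p)"
        unfolding A_def power_mult_distrib by (simp only: mult_ac)
      then show ?thesis unfolding one by simp
    qed
    finally show "C * M (Suc N) \<le> A * (exp 1 * q) ^ p" .
  qed (use ab in auto)
  also have "\<dots> = A * ((exp 1 * (b - a) * q) ^ p / fact p)"
    by (simp add: power_mult_distrib)
  finally have rem: "norm (Df j b - (\<Sum>i<p. ((b - a) ^ i / fact i) *\<^sub>R Df (j + i) a)) \<le>
      A * ((exp 1 * (b - a) * q) ^ p / fact p)" .
  have main: "norm (\<Sum>i<p. ((b - a) ^ i / fact i) *\<^sub>R Df (j + i) a) \<le>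
      (\<Sum>i<p. A * ((exp 1 * (b - a) * q) ^ i / fact i))"
  proof (rule sum_norm_le)
    fix i assume i: "i \<in> {..<p}"
    have "norm (Df (j + i) a) \<le> C * exp (real (j + i) - real (Suc N)) * M (j + i)"
      using jK by (intro small) auto
    also have "\<dots> \<le> C * exp (real (j + i) - real (Suc N)) * (M j * q ^ i)"
      using i C by (intro mult_left_mono Mi) auto
    also have "\<dots> = A * (exp 1 * q) ^ i"
    proof -
      have "exp (real (j + i) - real (Suc N)) = exp (real j - real (Suc N)) * exp 1 ^ i"
        unfolding exp_times_exp_one_power by (simp add: algebra_simps)
      then show ?thesis unfolding A_def power_mult_distrib by (simp only: mult_ac)
    qed
    finally have "(b - a) ^ i / fact i * norm (Df (j + i) a) \<le>
        (b - a) ^ i / fact i * (A * (exp 1 * q) ^ i)"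
      using ab by (intro mult_left_mono) auto
    moreover have "(b - a) ^ i / fact i * (A * (exp 1 * q) ^ i) = A * ((exp 1 * (b - a) * q) ^ i / fact i)"
      by (simp add: power_mult_distrib)
    moreover have "norm (((b - a) ^ i / fact i) *\<^sub>R Df (j + i) a) = (b - a) ^ i / fact i * norm (Df (j + i) a)"
      using ab by simp
    ultimately show "norm (((b - a) ^ i / fact i) *\<^sub>R Df (j + i) a) \<le>
        A * ((exp 1 * (b - a) * q) ^ i / fact i)"
      by linarith
  qed
  have "norm (Df j b) \<le> norm (Df j b - (\<Sum>i<p. ((b - a) ^ i / fact i) *\<^sub>R Df (j + i) a)) +
      norm (\<Sum>i<p. ((b - a) ^ i / fact i) *\<^sub>R Df (j + i) a)"
    using norm_triangle_ineq[of "Df j b - (\<Sum>i<p. ((b - a) ^ i / fact i) *\<^sub>R Df (j + i) a)"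
      "\<Sum>i<p. ((b - a) ^ i / fact i) *\<^sub>R Df (j + i) a"] by simp
  also have "\<dots> \<le> (\<Sum>i<Suc p. A * ((exp 1 * (b - a) * q) ^ i / fact i))"
    using rem main by simp
  also have "\<dots> = A * (\<Sum>i<Suc p. (exp 1 * (b - a) * q) ^ i / fact i)"
    by (simp only: sum_distrib_left)
  also have "\<dots> \<le> A * exp (exp 1 * (b - a) * q)"
    using A ab q by (intro mult_left_mono sum_power_fact_le_exp) auto
  also have "\<dots> \<le> A * exp 1"
    using A hq by (intro mult_left_mono) auto
  also have "\<dots> = C * exp (real j - real N) * M j"
  proof -
    have "exp (real j - real (Suc N)) * exp 1 = exp (real j - real N)"
      by (simp add: mult_exp_exp)
    then show ?thesis unfolding A_def by (metis mult.assoc mult.commute)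
  qed
  finally show ?thesis .
qed

text \<open>Downward induction on \<open>N\<close>, starting at \<open>N = n\<close>, where the sum
  is empty and only \<open>x = 0\<close> is left. By \<open>Bang_step\<close> each passage from
  \<open>Suc N\<close> to \<open>N\<close> extends the range by
  \<open>M N / M (Suc N) / exp 1\<close> at the price of a factor e; the sum of quotients measures
  how far the smallness at 0 spreads.\<close>

lemma Bang_estimate:
  fixes Df :: "nat \<Rightarrow> real \<Rightarrow> 'a::banach" and M :: "nat \<Rightarrow> real"
  assumes pos: "\<And>j. M j > 0"
    and lc: "\<And>i k. i \<le> k \<Longrightarrow> M (Suc i) / M i \<le> M (Suc k) / M k"
    and C: "C \<ge> 0"
    and Df: "\<And>m t. t \<in> {0..\<delta>} \<Longrightarrow>
      (Df m has_vector_derivative Df (Suc m) t) (at t within {0..\<delta>})"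
    and bd: "\<And>j t. t \<in> {0..\<delta>} \<Longrightarrow> norm (Df j t) \<le> C * M j"
    and van: "\<And>j. K \<le> j \<Longrightarrow> j < n \<Longrightarrow> Df j 0 = 0"
    and N: "N \<le> n" and x: "x \<in> {0..\<delta>}"
    and sum: "x * exp 1 \<le> (\<Sum>i\<in>{N..<n}. M i / M (Suc i))"
    and jK: "j \<ge> K"
  shows "norm (Df j x) \<le> C * exp (real j - real N) * M j"
  using N x sum jK
proof (induction N arbitrary: x j rule: inc_induct)
  case base
  then have [simp]: "x = 0" by (simp add: mult_le_0_iff)
  show ?case
  proof (cases "j < n")
    case True
    then show ?thesis using van base C less_imp_le[OF pos[of j]] by simp
  next
    case False
    then have "C * M j * 1 \<le> C * M j * exp (real j - real n)"
      using C less_imp_le[OF pos[of j]] by (intro mult_left_mono) auto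
    then show ?thesis using bd[of 0 j] base by (simp add: mult_ac)
  qed
next
  case (step N)
  define r where "r = M N / M (Suc N)"
  \<comment> \<open>Bang's step is applied between \<open>y\<close> and \<open>x\<close>. The cut at
    0 keeps \<open>y\<close> in the interval; without it the step has full length and the remaining
    sum reaches \<open>y\<close>.\<close>
  define y where "y = max 0 (x - r / exp 1)"
  have r: "r \<ge> 0" using pos by (simp add: r_def less_imp_le)
  have "r / exp 1 \<ge> 0" using r by simp
  then have y: "0 \<le> y" "y \<le> x" "y \<in> {0..\<delta>}" using step.prems by (auto simp: y_def)
  have xy: "(x - y) * exp 1 \<le> r"
    using r step.prems by (auto simp: y_def max_def field_simps)
  have tail: "(\<Sum>i\<in>{N..<n}. M i / M (Suc i)) = r + (\<Sum>i\<in>{Suc N..<n}. M i / M (Suc i))"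
    using step.hyps by (simp add: sum.atLeast_Suc_lessThan r_def)
  have "0 \<le> (\<Sum>i\<in>{Suc N..<n}. M i / M (Suc i))"
    using pos by (intro sum_nonneg) (simp add: less_imp_le)
  then have "y * exp 1 \<le> (\<Sum>i\<in>{Suc N..<n}. M i / M (Suc i))"
    using step.prems(2) unfolding tail y_def by (auto simp: max_def left_diff_distrib)
  then have "norm (Df k y) \<le> C * exp (real k - real (Suc N)) * M k" if "k \<ge> K" for k
    using step.IH[OF y(3) _ that] by simp
  moreover have sub: "{y..x} \<subseteq> {0..\<delta>}" using y step.prems by auto
  ultimately show ?case
    using xy step.prems y sub
    by (intro Bang_step[where Df = Df and M = M and a = y and b = x and K = K and N = N, OF pos lc])
       (auto simp: r_def C intro!: bd has_vector_derivative_within_subset[OF Df sub])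
qed

section \<open>Leading coefficients of polynomials bounded on an interval\<close>

text \<open>The leading terms cancel in a forward difference. In the induction, multiplication by
  the variable turns the difference into \<open>pCons 0 (Q - p) + smult h Q\<close>. A degree bound
  and a coefficient at a fixed index, rather than the exact degree, keep the statement valid when
  top coefficients vanish.\<close>

lemma coeff_shift_diff:
  fixes p :: "'a::comm_ring_1 poly"
  assumes "degree p \<le> Suc m"
  shows "degree (pcompose p [:h, 1:] - p) \<le> m \<and>
    coeff (pcompose p [:h, 1:] - p) m = of_nat (Suc m) * h * coeff p (Suc m)"
  using assms
proof (induction p arbitrary: m)
  case (pCons a p)
  define Q where "Q = pcompose p [:h, 1:]"
  have eq: "pcompose (pCons a p) [:h, 1:] - pCons a p = pCons 0 (Q - p) + smult h Q"
    by (simp add: pcompose_pCons Q_def algebra_simps)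
  show ?case
  proof (cases "p = 0")
    case True
    then show ?thesis by simp
  next
    case False
    then have d: "degree p \<le> m" using pCons.prems by simp
    show ?thesis
    proof (cases m)
      case 0
      then obtain c where "p = [:c:]" using d by (auto elim: degree_eq_zeroE)
      then show ?thesis using 0 by (simp add: pcompose_pCons)
    next
      case (Suc k)
      have IH: "degree (Q - p) \<le> k" "coeff (Q - p) k = of_nat (Suc k) * h * coeff p (Suc k)"
        using pCons.IH[of k] d Suc by (auto simp: Q_def)
      have dQ: "degree Q \<le> m"
        unfolding Q_def using degree_pcompose_le[of p "[:h, 1:]"] d
        by (auto intro: order_trans split: if_splits)
      have "coeff (Q - p) (Suc k) = 0" using IH(1) by (intro coeff_eq_0) auto
      then have "coeff Q m = coeff p m" using coeff_diff[of Q p "Suc k"] Suc by simp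
      then have "coeff (pCons 0 (Q - p) + smult h Q) m = of_nat (Suc m) * h * coeff p m"
        using IH(2) Suc by (simp add: algebra_simps)
      moreover have "degree (pCons 0 (Q - p) + smult h Q) \<le> m"
        using IH(1) dQ Suc degree_smult_le[of h Q]
        by (intro degree_add_le) (auto intro: order_trans[OF degree_pCons_le])
      ultimately show ?thesis unfolding eq by simp
    qed
  qed
qed simp

text \<open>The m-th forward difference of step \<open>h\<close> is the constant
  \<open>fact m * h ^ m * coeff p m\<close>. Each difference at most doubles the bound and shortens
  the interval by \<open>h\<close>.\<close>

lemma lead_coeff_bound_step:
  fixes p :: "complex poly" and h :: real
  assumes "h \<ge> 0" "degree p \<le> m"
    and "\<And>x. a \<le> x \<Longrightarrow> x \<le> a + real m * h \<Longrightarrow> norm (poly p (of_real x)) \<le> B"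
  shows "norm (coeff p m) * fact m * h ^ m \<le> 2 ^ m * B"
  using assms
proof (induction m arbitrary: p B)
  case 0
  then obtain c where "p = [:c:]" by (auto elim: degree_eq_zeroE)
  then show ?case using 0(3)[of a] by simp
next
  case (Suc m)
  define q where "q = pcompose p [:of_real h, 1:] - p"
  have q: "degree q \<le> m" "coeff q m = of_nat (Suc m) * of_real h * coeff p (Suc m)"
    using coeff_shift_diff[OF Suc.prems(2), of "of_real h"] by (auto simp: q_def)
  have "norm (coeff q m) * fact m * h ^ m \<le> 2 ^ m * (2 * B)"
  proof (rule Suc.IH[OF Suc.prems(1) q(1)])
    fix x assume x: "a \<le> x" "x \<le> a + real m * h"
    have "poly q (of_real x) = poly p (of_real (x + h)) - poly p (of_real x)"
      by (simp add: q_def poly_pcompose add.commute)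
    then have "norm (poly q (of_real x)) \<le> norm (poly p (of_real (x + h))) + norm (poly p (of_real x))"
      by (simp add: norm_triangle_ineq4)
    also have "\<dots> \<le> B + B"
    proof (rule add_mono)
      have "real (Suc m) * h = real m * h + h" by (simp add: algebra_simps)
      then have "a \<le> x + h" "x + h \<le> a + real (Suc m) * h" "x \<le> a + real (Suc m) * h"
        using x Suc.prems(1) by linarith+
      then show "norm (poly p (of_real (x + h))) \<le> B" "norm (poly p (of_real x)) \<le> B"
        using x Suc.prems(3)[of x] Suc.prems(3)[of "x + h"] by auto
    qed
    finally show "norm (poly q (of_real x)) \<le> 2 * B" by simp
  qed
  then show ?case
    using Suc.prems(1) by (simp add: q(2) norm_mult algebra_simps del: of_nat_Suc)
qed

text \<open>Here \<open>h = \<delta> / m\<close>, so that \<open>m\<close> steps fill the interval,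
  and \<open>m ^ m / fact m \<le> exp 1 ^ m\<close>, being one term of the exponential
  series.\<close>

lemma lead_coeff_bound:
  fixes p :: "complex poly"
  assumes \<delta>: "\<delta> > 0" and deg: "degree p \<le> m"
    and B: "\<And>x. 0 \<le> x \<Longrightarrow> x \<le> \<delta> \<Longrightarrow> norm (poly p (of_real x)) \<le> B"
  shows "norm (coeff p m) \<le> B * (2 * exp 1 / \<delta>) ^ m"
proof (cases "m = 0")
  case True
  then show ?thesis using B[of 0] \<delta> deg by (auto elim!: degree_eq_zeroE)
next
  case False
  have "norm (coeff p m) * fact m * (\<delta> / m) ^ m \<le> 2 ^ m * B"
    using \<delta> deg B False by (intro lead_coeff_bound_step[where a = 0]) auto
  then have 1: "norm (coeff p m) * (\<delta> ^ m * (fact m / real m ^ m)) \<le> 2 ^ m * B"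
    by (simp add: power_divide mult_ac)
  have "real m ^ m / fact m \<le> (\<Sum>i<Suc m. real m ^ i / fact i)"
    by (simp add: sum_nonneg)
  also have "\<dots> \<le> exp (real m)" by (rule sum_power_fact_le_exp) simp
  finally have "real m ^ m / fact m \<le> exp 1 ^ m" by (simp add: exp_of_nat_mult[symmetric])
  then have "1 \<le> exp 1 ^ m * (fact m / real m ^ m)"
    using False by (simp add: field_simps)
  then have "norm (coeff p m) * \<delta> ^ m * 1 \<le>
      norm (coeff p m) * \<delta> ^ m * (exp 1 ^ m * (fact m / real m ^ m))"
    using \<delta> by (intro mult_left_mono) auto
  also have "\<dots> \<le> exp 1 ^ m * (2 ^ m * B)"
    using mult_left_mono[OF 1, of "exp 1 ^ m"] by (simp add: mult_ac)
  finally have "norm (coeff p m) \<le> exp 1 ^ m * (2 ^ m * B) / \<delta> ^ m"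
    using \<delta> by (simp add: pos_le_divide_eq)
  then show ?thesis by (simp add: power_divide power_mult_distrib mult_ac)
qed


section \<open>Weight sequences\<close>

lemma phi_star_zero:
  assumes "\<omega> \<in> weight_class"
  shows "phi_star \<omega> 0 = 0"
proof (rule antisym)
  show "phi_star \<omega> 0 \<le> 0"
    using phi_nonneg[OF assms] by (intro phi_star_least) simp
  have "phi \<omega> 0 = 0" using assms by (simp add: weight_class_def weight_function_def phi_def)
  then show "0 \<le> phi_star \<omega> 0" using phi_star_upper[OF assms, of 0 0] by simp
qed

lemma weight_seq_zero: "\<omega> \<in> weight_class \<Longrightarrow> weight_seq \<omega> l 0 = 1"
  by (simp add: weight_seq_def phi_star_zero)

lemma phi_star_mono:
  assumes "\<omega> \<in> weight_class" "x \<le> y"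
  shows "phi_star \<omega> x \<le> phi_star \<omega> y"
proof (rule phi_star_least)
  fix z :: real assume "0 \<le> z"
  then have "x * z \<le> y * z" using assms(2) by (intro mult_right_mono)
  then show "x * z - phi \<omega> z \<le> phi_star \<omega> y"
    using phi_star_upper[OF assms(1) \<open>0 \<le> z\<close>, of y] by linarith
qed

text \<open>A supremum of affine functions of \<open>x\<close> is convex; the midpoint form suffices
  for logarithmic convexity of the weight sequences, since the points \<open>l * j\<close> are
  equidistant.\<close>

lemma phi_star_midpoint:
  assumes "\<omega> \<in> weight_class"
  shows "2 * phi_star \<omega> x \<le> phi_star \<omega> (x - h) + phi_star \<omega> (x + h)"
proof -
  have "phi_star \<omega> x \<le> (phi_star \<omega> (x - h) + phi_star \<omega> (x + h)) / 2"
  proof (rule phi_star_least)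
    fix z :: real assume z: "0 \<le> z"
    show "x * z - phi \<omega> z \<le> (phi_star \<omega> (x - h) + phi_star \<omega> (x + h)) / 2"
      using phi_star_upper[OF assms z, of "x - h"] phi_star_upper[OF assms z, of "x + h"]
      by (simp add: algebra_simps)
  qed
  then show ?thesis by simp
qed

lemma weight_seq_quotient_mono:
  assumes W: "\<omega> \<in> weight_class" and l: "l > 0" and "i \<le> k"
  shows "weight_seq \<omega> l (Suc i) / weight_seq \<omega> l i \<le> weight_seq \<omega> l (Suc k) / weight_seq \<omega> l k"
proof -
  have "incseq (\<lambda>i. weight_seq \<omega> l (Suc i) / weight_seq \<omega> l i)"
  proof (rule incseq_SucI)
    fix n
    have "2 * phi_star \<omega> (l * real (Suc n)) \<le> phi_star \<omega> (l * real n) + phi_star \<omega> (l * real (Suc (Suc n)))"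
      using phi_star_midpoint[OF W, of "l * real (Suc n)" l] by (simp add: algebra_simps)
    then have "1 / l * (2 * phi_star \<omega> (l * real (Suc n))) \<le>
        1 / l * (phi_star \<omega> (l * real n) + phi_star \<omega> (l * real (Suc (Suc n))))"
      using l by (intro mult_left_mono) auto
    then have "1 / l * phi_star \<omega> (l * real (Suc n)) - 1 / l * phi_star \<omega> (l * real n) \<le>
        1 / l * phi_star \<omega> (l * real (Suc (Suc n))) - 1 / l * phi_star \<omega> (l * real (Suc n))"
      by (simp only: distrib_left)
    then show "weight_seq \<omega> l (Suc n) / weight_seq \<omega> l n \<le>
        weight_seq \<omega> l (Suc (Suc n)) / weight_seq \<omega> l (Suc n)"
      unfolding weight_seq_def exp_diff[symmetric] by (simp only: exp_le_cancel_iff)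
  qed
  then show ?thesis using \<open>i \<le> k\<close> by (rule incseqD)
qed

text \<open>The nontrivial half of biconjugation: a supporting line of the convex function \<^term>\<open>phi \<omega>\<close>
  at \<open>y\<close> has nonnegative slope \<open>x\<close>.\<close>

lemma phi_supporting_line:
  assumes W: "\<omega> \<in> weight_class"
  obtains x where "x \<ge> 0" "phi_star \<omega> x \<le> x * y - phi \<omega> y"
proof -
  have conv: "convex_on UNIV (phi \<omega>)" using W by (simp add: weight_class_def)
  define x where "x = Inf ((\<lambda>t. (phi \<omega> y - phi \<omega> t) / (y - t)) ` ({y<..} \<inter> UNIV))"
  have line: "phi \<omega> z \<ge> phi \<omega> y + x * (z - y)" for z
    unfolding x_def by (rule convex_le_Inf_differential[OF conv]) auto
  have "mono_on {0..} \<omega>" using W by (simp add: weight_class_def weight_function_def)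
  then have "phi \<omega> (y - 1) \<le> phi \<omega> y"
    unfolding phi_def by (rule mono_onD) auto
  then have "x \<ge> 0" using line[of "y - 1"] by simp
  moreover have "phi_star \<omega> x \<le> x * y - phi \<omega> y"
    using line by (intro phi_star_least) (simp add: algebra_simps)
  ultimately show ?thesis by (rule that)
qed

section \<open>Quasianalyticity as divergence of the series of quotients\<close>

text \<open>By biconjugation \<open>\<omega> t\<close> is at most
  \<open>x * y - phi_star \<omega> x\<close> with \<open>y = ln t\<close> and a suitable
  \<open>x\<close>. Rounding \<open>x\<close> down to \<open>l * j\<close> costs at most
  \<open>l * ln t\<close>; what remains is \<open>l\<close> times a telescoping sum of logarithms,
  whose negative terms are dropped.\<close>

lemma weight_le_sum_log:
  assumes W: "\<omega> \<in> weight_class" and l: "l > 0" and t: "t \<ge> 1"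
  obtains j where "\<omega> t \<le> l * ln t +
    l * (\<Sum>i<j. max 0 (ln (t * (weight_seq \<omega> l i / weight_seq \<omega> l (Suc i)))))"
proof -
  define y where "y = ln t"
  have y: "y \<ge> 0" "exp y = t" using t by (auto simp: y_def)
  obtain x where x: "x \<ge> 0" "phi_star \<omega> x \<le> x * y - phi \<omega> y"
    using phi_supporting_line[OF W] by blast
  define j where "j = nat \<lfloor>x / l\<rfloor>"
  define r where "r i = weight_seq \<omega> l i / weight_seq \<omega> l (Suc i)" for i
  have r: "r i > 0" for i by (simp add: r_def weight_seq_pos)
  have "real j \<le> x / l" "x / l \<le> real j + 1"
    using x(1) l unfolding j_def by (simp, linarith)
  then have jx: "l * real j \<le> x" "x \<le> l * (real j + 1)"
    using l by (auto simp: field_simps)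
  have lnr: "ln (r i) = ln (weight_seq \<omega> l i) - ln (weight_seq \<omega> l (Suc i))" for i
    unfolding r_def using weight_seq_pos[of \<omega> l i] weight_seq_pos[of \<omega> l "Suc i"] by (simp add: ln_div)
  have tele: "(\<Sum>i<j. ln (r i)) = - (1 / l * phi_star \<omega> (l * real j))"
    unfolding lnr using sum_lessThan_telescope'[of "\<lambda>i. ln (weight_seq \<omega> l i)" j]
    by (simp only: weight_seq_def phi_star_zero[OF W] ln_exp) (simp add: phi_star_zero[OF W])
  have "\<omega> t = phi \<omega> y" using y by (simp add: phi_def)
  also have "\<dots> \<le> x * y - phi_star \<omega> x" using x by simp
  also have "\<dots> \<le> l * (real j + 1) * y - phi_star \<omega> (l * real j)"
    using mult_right_mono[OF jx(2) y(1)] phi_star_mono[OF W jx(1)] by linarith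
  also have "\<dots> = l * ln t + l * (real j * y - 1 / l * phi_star \<omega> (l * real j))"
    using l by (simp add: y_def algebra_simps)
  also have "real j * y - 1 / l * phi_star \<omega> (l * real j) = (\<Sum>i<j. ln (t * r i))"
  proof -
    have "ln (t * r i) = y + ln (r i)" for i
      using t r[of i] by (simp add: y_def ln_mult)
    then show ?thesis using tele by (simp add: sum.distrib)
  qed
  also have "l * (\<Sum>i<j. ln (t * r i)) \<le> l * (\<Sum>i<j. max 0 (ln (t * r i)))"
    using l by (intro mult_left_mono sum_mono) auto
  finally have "\<omega> t \<le> l * ln t + l * (\<Sum>i<j. max 0 (ln (t * r i)))" by simp
  then show ?thesis unfolding r_def by (rule that)
qed

text \<open>The integrand lives on \<open>t \<ge> 1 / r\<close>, where
  \<open>- (ln (t * r) + 1) / t\<close> is an antiderivative with value \<open>- r\<close> at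
  \<open>1 / r\<close> and limit 0. It is only an inequality because \<open>1 / r\<close> may be
  less than 1.\<close>

lemma nn_integral_log_plus:
  assumes r: "r > 0"
  shows "(\<integral>\<^sup>+ t \<in> {1..}. ennreal (max 0 (ln (t * r)) / t ^ 2) \<partial>lborel) \<le> ennreal r"
proof -
  have "(\<integral>\<^sup>+ t \<in> {1..}. ennreal (max 0 (ln (t * r)) / t ^ 2) \<partial>lborel) \<le>
      (\<integral>\<^sup>+ t. ennreal (ln (t * r) / t ^ 2) * indicator {1 / r..} t \<partial>lborel)"
  proof (rule nn_integral_mono)
    fix t :: real
    show "ennreal (max 0 (ln (t * r)) / t ^ 2) * indicator {1..} t \<le>
        ennreal (ln (t * r) / t ^ 2) * indicator {1 / r..} t"
    proof (cases "t \<ge> 1 \<and> t \<ge> 1 / r")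
      case True
      then have "t * r \<ge> 1" using r by (simp add: field_simps)
      then show ?thesis using True by (simp add: indicator_def)
    next
      case False
      show ?thesis
      proof (cases "t \<ge> 1")
        case True
        then have "t * r < 1" "t * r > 0" using False r by (auto simp: field_simps)
        then show ?thesis by (simp add: max_def indicator_def)
      qed (simp add: indicator_def)
    qed
  qed
  also have "\<dots> = ennreal (0 - (- (ln (1 / r * r) + 1) / (1 / r)))"
  proof (rule nn_integral_FTC_atLeast)
    fix x :: real assume "1 / r \<le> x"
    then have xr: "x > 0" "x * r \<ge> 1"
      using r by (auto simp: field_simps intro: less_le_trans[of 0 "1 / r"])
    show "((\<lambda>t. - (ln (t * r) + 1) / t) has_real_derivative ln (x * r) / x\<^sup>2) (at x)"
      using xr r by (auto intro!: derivative_eq_intros simp: field_simps power2_eq_square)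
    show "0 \<le> ln (x * r) / x\<^sup>2" using xr by simp
  next
    have "((\<lambda>t. - (ln t + (ln r + 1)) / t) \<longlongrightarrow> 0) at_top"
      by real_asymp
    moreover have "\<forall>\<^sub>F t in at_top. - (ln t + (ln r + 1)) / t = - (ln (t * r) + 1) / t"
      using eventually_gt_at_top[of 0] by eventually_elim (use r in \<open>simp add: ln_mult\<close>)
    ultimately show "((\<lambda>t. - (ln (t * r) + 1) / t) \<longlongrightarrow> 0) at_top"
      by (rule Lim_transform_eventually)
  qed simp
  also have "\<dots> = ennreal r" using r by simp
  finally show ?thesis .
qed

text \<open>One half of the Denjoy-Carleman theorem: integrating \<open>weight_le_sum_log\<close>
  against \<open>1 / t ^ 2\<close> bounds the integral of \<open>\<sigma> t / t ^ 2\<close> by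
  \<open>l * (1 + suminf r)\<close>, where the 1 comes from the term \<open>ln t\<close>.\<close>

lemma quasianalytic_not_summable:
  assumes W: "\<sigma> \<in> weight_class" and Q: "quasianalytic \<sigma>" and l: "l > 0"
  shows "\<not> summable (\<lambda>i. weight_seq \<sigma> l i / weight_seq \<sigma> l (Suc i))"
proof
  define r where "r i = weight_seq \<sigma> l i / weight_seq \<sigma> l (Suc i)" for i
  have r: "r i > 0" for i by (simp add: r_def weight_seq_pos)
  assume "summable (\<lambda>i. weight_seq \<sigma> l i / weight_seq \<sigma> l (Suc i))"
  then have summ: "summable r" by (simp add: r_def[abs_def])
  define H where "H c t = ennreal (max 0 (ln (t * c)) / t ^ 2) * indicator {1..} t" for c t :: real
  have H_meas [measurable]: "H c \<in> borel_measurable lborel" for c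
    unfolding H_def by measurable
  have H_int: "(\<integral>\<^sup>+ t. H c t \<partial>lborel) \<le> ennreal c" if "c > 0" for c
    unfolding H_def using nn_integral_log_plus[OF that] .
  \<comment> \<open>The number \<open>j\<close> of terms depends on \<open>t\<close>; the full
    series of nonnegative terms gives a uniform bound, and sum and integral can be
    exchanged.\<close>
  have pointwise: "ennreal (\<sigma> t / t ^ 2) * indicator {1..} t \<le>
      ennreal l * H 1 t + ennreal l * (\<Sum>i. H (r i) t)" for t
  proof (cases "t \<ge> 1")
    case True
    obtain j where j: "\<sigma> t \<le> l * ln t + l * (\<Sum>i<j. max 0 (ln (t * r i)))"
      using weight_le_sum_log[OF W l True] unfolding r_def by blast
    have "\<sigma> t / t ^ 2 \<le> l * (max 0 (ln (t * 1)) / t ^ 2) + l * (\<Sum>i<j. max 0 (ln (t * r i)) / t ^ 2)"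
      using divide_right_mono[OF j, of "t ^ 2"] True
      by (simp add: add_divide_distrib sum_divide_distrib[symmetric])
    then have "ennreal (\<sigma> t / t ^ 2) \<le>
        ennreal (l * (max 0 (ln (t * 1)) / t ^ 2) + l * (\<Sum>i<j. max 0 (ln (t * r i)) / t ^ 2))"
      by (rule ennreal_leI)
    also have "\<dots> = ennreal l * H 1 t + ennreal l * (\<Sum>i<j. H (r i) t)"
    proof -
      have "ennreal l * H 1 t = ennreal (l * (max 0 (ln (t * 1)) / t ^ 2))"
        using l True unfolding H_def by (subst ennreal_mult) auto
      moreover have "ennreal l * (\<Sum>i<j. H (r i) t) = ennreal (l * (\<Sum>i<j. max 0 (ln (t * r i)) / t ^ 2))"
        using l True unfolding H_def by (subst ennreal_mult) (auto simp: sum_nonneg)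
      ultimately show ?thesis using l True by (simp add: ennreal_plus sum_nonneg)
    qed
    also have "\<dots> \<le> ennreal l * H 1 t + ennreal l * (\<Sum>i. H (r i) t)"
      by (intro add_left_mono mult_left_mono sum_le_suminf) auto
    finally show ?thesis using True by simp
  qed simp
  have "(\<integral>\<^sup>+ t \<in> {1..}. ennreal (\<sigma> t / t ^ 2) \<partial>lborel) \<le>
      (\<integral>\<^sup>+ t. ennreal l * H 1 t + ennreal l * (\<Sum>i. H (r i) t) \<partial>lborel)"
    by (intro nn_integral_mono pointwise)
  also have "\<dots> = ennreal l * (\<integral>\<^sup>+ t. H 1 t \<partial>lborel) + ennreal l * (\<Sum>i. \<integral>\<^sup>+ t. H (r i) t \<partial>lborel)"
    by (simp add: nn_integral_add nn_integral_cmult nn_integral_suminf)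
  also have "\<dots> \<le> ennreal l * ennreal 1 + ennreal l * (\<Sum>i. ennreal (r i))"
    using r by (intro add_mono mult_left_mono suminf_le H_int) auto
  also have "(\<Sum>i. ennreal (r i)) = ennreal (suminf r)"
    using r summ by (intro suminf_ennreal2) (auto intro: less_imp_le)
  also have "ennreal l * ennreal 1 + ennreal l * ennreal (suminf r) < \<infinity>"
    by (simp add: ennreal_mult_less_top)
  finally show False using Q by (simp add: quasianalytic_def)
qed

text \<open>The value \<open>y = ln t\<close> in the supremum defining \<open>phi_star\<close>;
  \<open>t\<close> is left free for a later choice.\<close>

lemma weight_seq_lower:
  assumes W: "\<omega> \<in> weight_class" and l: "l > 0" and t: "t \<ge> 1"
  shows "t ^ n * exp (- (\<omega> t / l)) \<le> weight_seq \<omega> l n"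
proof -
  have "l * real n * ln t - phi \<omega> (ln t) \<le> phi_star \<omega> (l * real n)"
    using t by (intro phi_star_upper[OF W]) auto
  then have "1 / l * (l * real n * ln t - \<omega> t) \<le> 1 / l * phi_star \<omega> (l * real n)"
    using l t by (intro mult_left_mono) (auto simp: phi_def)
  then have "real n * ln t - \<omega> t / l \<le> 1 / l * phi_star \<omega> (l * real n)"
    using l by (simp add: algebra_simps)
  moreover have "t ^ n * exp (- (\<omega> t / l)) = exp (real n * ln t - \<omega> t / l)"
    using t by (simp add: exp_diff exp_minus exp_of_nat_mult divide_inverse)
  ultimately show ?thesis by (simp add: weight_seq_def)
qed


section \<open>Polynomials in lacunary series\<close>

text \<open>A nonzero polynomial does not vanish on a whole infinite grid; monomials are multisets
  of variables. One variable \<open>a\<close> is split off: the coefficient of some power of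
  \<open>a\<close> is nonzero at a point by induction, and the resulting univariate polynomial has
  finitely many roots.\<close>

lemma ex_nonzero_evaluation:
  fixes c :: "'v multiset \<Rightarrow> 'a::idom"
  assumes "finite V" "finite T" "T \<noteq> {}" "\<And>m. m \<in> T \<Longrightarrow> set_mset m \<subseteq> V"
    and "\<And>m. m \<in> T \<Longrightarrow> c m \<noteq> 0" and X: "infinite X"
  shows "\<exists>v. (\<forall>x. v x \<in> X) \<and> (\<Sum>m\<in>T. c m * prod_mset (image_mset v m)) \<noteq> 0"
  using assms(1-5)
proof (induction V arbitrary: T c rule: finite_induct)
  case empty
  have "X \<noteq> {}" using X by auto
  then obtain x where "x \<in> X" by blast
  moreover have "T = {{#}}" using empty.prems by auto
  ultimately show ?case using empty.prems by (intro exI[of _ "\<lambda>_. x"]) auto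
next
  case (insert a V)
  define R where "R m = filter_mset (\<lambda>b. b \<noteq> a) m" for m
  have split: "m = R m + replicate_mset (count m a) a" for m
    by (rule multiset_eqI) (auto simp: R_def)
  obtain m0 where m0: "m0 \<in> T" using insert.prems by blast
  define k where "k = count m0 a"
  define U where "U = {m \<in> T. count m a = k}"
  have inj: "inj_on R U"
  proof (rule inj_onI)
    fix m m' assume *: "m \<in> U" "m' \<in> U" "R m = R m'"
    have "m = R m + replicate_mset k a" using split[of m] *(1) by (simp add: U_def)
    moreover have "m' = R m' + replicate_mset k a" using split[of m'] *(2) by (simp add: U_def)
    ultimately show "m = m'" using *(3) by simp
  qed
  have cU: "c (R m + replicate_mset k a) = c m" if "m \<in> U" for m
    using split[of m] that by (simp add: U_def)
  have "\<exists>v. (\<forall>x. v x \<in> X) \<and>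
      (\<Sum>m\<in>R ` U. c (m + replicate_mset k a) * prod_mset (image_mset v m)) \<noteq> 0"
  proof (rule insert.IH)
    show "finite (R ` U)" "R ` U \<noteq> {}" using insert.prems m0 by (auto simp: U_def k_def)
    show "set_mset m \<subseteq> V" if "m \<in> R ` U" for m
      using that insert.prems(3) by (fastforce simp: U_def R_def)
    show "c (m + replicate_mset k a) \<noteq> 0" if "m \<in> R ` U" for m
      using that cU insert.prems(4) by (auto simp: U_def)
  qed
  then obtain v where v: "\<And>x. v x \<in> X"
    "(\<Sum>m\<in>R ` U. c (m + replicate_mset k a) * prod_mset (image_mset v m)) \<noteq> 0" by blast
  \<comment> \<open>All variables except \<open>a\<close> are evaluated at \<open>v\<close>; the
    coefficient of \<open>Q\<close> at \<open>k\<close> is the nonzero sum in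
    \<open>v(2)\<close>.\<close>
  define Q where "Q = (\<Sum>m\<in>T. monom (c m * prod_mset (image_mset v (R m))) (count m a))"
  have "coeff Q k = (\<Sum>m\<in>T. if count m a = k then c m * prod_mset (image_mset v (R m)) else 0)"
    by (simp add: Q_def coeff_sum)
  also have "\<dots> = (\<Sum>m\<in>U. c m * prod_mset (image_mset v (R m)))"
    using insert.prems(1) by (simp add: U_def sum.inter_filter)
  also have "\<dots> = (\<Sum>m\<in>R ` U. c (m + replicate_mset k a) * prod_mset (image_mset v m))"
    by (simp add: sum.reindex[OF inj] cU)
  finally have "Q \<noteq> 0" using v(2) by auto
  then have "infinite (X - {x. poly Q x = 0})"
    using X by (intro Diff_infinite_finite poly_roots_finite)
  then have "X - {x. poly Q x = 0} \<noteq> {}" by (metis finite.emptyI)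
  then obtain x where x: "x \<in> X" "poly Q x \<noteq> 0" by blast
  define v' where "v' = v(a := x)"
  have "prod_mset (image_mset v' m) = prod_mset (image_mset v (R m)) * x ^ count m a" for m
  proof -
    have "image_mset v' (R m) = image_mset v (R m)"
      by (rule image_mset_cong) (auto simp: R_def v'_def)
    then show ?thesis
      by (subst split[of m]) (simp add: v'_def)
  qed
  then have "(\<Sum>m\<in>T. c m * prod_mset (image_mset v' m)) = poly Q x"
    by (simp add: Q_def poly_sum poly_monom mult.assoc)
  moreover have "v' y \<in> X" for y using v(1) x(1) by (simp add: v'_def)
  ultimately show ?case using x(2) by (intro exI[of _ v']) auto
qed

section \<open>Functions on the reals with prescribed finite patterns\<close>

text \<open>Step functions coded by lists of rational intervals with values; the first interval
  containing \<open>x\<close> decides. There are only countably many codes.\<close>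

fun interval_lookup :: "(rat \<times> rat \<times> nat) list \<Rightarrow> real \<Rightarrow> nat" where
  "interval_lookup [] x = 0"
| "interval_lookup ((p, q, w) # xs) x =
     (if of_rat p < x \<and> x < of_rat q then w else interval_lookup xs x)"

text \<open>A new point is served by an interval around it that misses the other points, put in
  front of the list.\<close>

lemma ex_interval_lookup:
  assumes "finite A"
  shows "\<exists>xs. \<forall>x\<in>A. interval_lookup xs x = w x"
  using assms
proof (induction A rule: finite_induct)
  case (insert a A)
  then obtain xs where xs: "\<forall>x\<in>A. interval_lookup xs x = w x" by blast
  obtain e where e: "e > 0" "\<And>x. x \<in> A \<Longrightarrow> x \<noteq> a \<Longrightarrow> e \<le> dist a x"
    using finite_set_avoid[OF insert.hyps(1), of a] by blast
  obtain p where p: "a - e < of_rat p" "of_rat p < a" using of_rat_dense[of "a - e" a] e by auto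
  obtain q where q: "a < of_rat q" "of_rat q < a + e" using of_rat_dense[of a "a + e"] e by auto
  have "\<not> (of_rat p < x \<and> x < of_rat q)" if "x \<in> A" for x
  proof -
    have "x \<noteq> a" using that insert.hyps(2) by auto
    then have "e \<le> \<bar>a - x\<bar>" using e(2)[OF that] by (simp add: dist_real_def)
    then show ?thesis using p q by linarith
  qed
  then show ?case
    using xs p q by (intro exI[of _ "(p, q, w a) # xs"]) auto
qed simp

text \<open>The index \<open>k\<close> codes a pair of which only the second component, a step
  function, matters, so each step function recurs infinitely often. Thus countably many coefficients
  can separate continuum many generators.\<close>

lemma independent_family:
  obtains u :: "nat \<Rightarrow> real \<Rightarrow> nat"
  where "\<And>A w. finite A \<Longrightarrow> \<exists>\<^sub>\<infinity>k. \<forall>x\<in>A. u k x = w x"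
proof
  define u where "u k = interval_lookup (snd (from_nat k :: nat \<times> (rat \<times> rat \<times> nat) list))" for k
  fix A :: "real set" and w :: "real \<Rightarrow> nat" assume "finite A"
  then obtain xs where xs: "\<forall>x\<in>A. interval_lookup xs x = w x" using ex_interval_lookup by blast
  have "infinite (range (\<lambda>i::nat. to_nat (i, xs)))"
    by (rule range_inj_infinite) (auto simp: inj_def)
  moreover have "range (\<lambda>i::nat. to_nat (i, xs)) \<subseteq> {k. \<forall>x\<in>A. u k x = w x}"
    using xs by (auto simp: u_def)
  ultimately show "\<exists>\<^sub>\<infinity>k. \<forall>x\<in>A. u k x = w x"
    unfolding INFM_iff_infinite using infinite_super by blast
qed

section \<open>Coefficients of monomials in lacunary series\<close>

definition lacunary :: "(nat \<Rightarrow> nat) \<Rightarrow> (nat \<Rightarrow> 'a::zero) \<Rightarrow> 'a fps" where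
  "lacunary n a = Abs_fps (\<lambda>j. if j \<in> range n then a (inv n j) else 0)"

lemma lacunary_nth_range: "strict_mono n \<Longrightarrow> fps_nth (lacunary n a) (n k) = a k"
  by (simp add: lacunary_def strict_mono_imp_inj_on)

lemma lacunary_nth_eq_0: "j \<notin> range n \<Longrightarrow> fps_nth (lacunary n a) j = 0"
  by (simp add: lacunary_def)

definition fps_monomial :: "('v \<Rightarrow> 'a::comm_ring_1 fps) \<Rightarrow> 'v multiset \<Rightarrow> 'a fps" where
  "fps_monomial F m = prod_mset (image_mset F m)"

text \<open>A sum of \<open>size m\<close> exponents that stays below \<open>n (Suc k)\<close> can
  only use \<open>n 0\<close> to \<open>n k\<close>, so it is at most
  \<open>size m * n k\<close>.\<close>

lemma fps_monomial_lacunary_nth_eq_0: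
  fixes a :: "'v \<Rightarrow> nat \<Rightarrow> 'a::comm_ring_1"
  assumes n: "strict_mono n" and "size m * n k < j" "j < n (Suc k)"
  shows "fps_nth (fps_monomial (\<lambda>x. lacunary n (a x)) m) j = 0"
  using assms(2,3)
proof (induction m arbitrary: j)
  case (add x m)
  have "fps_nth (lacunary n (a x)) i * fps_nth (fps_monomial (\<lambda>x. lacunary n (a x)) m) (j - i) = 0"
    if i: "i \<le> j" for i
  proof (cases "i \<in> range n")
    case True
    then obtain r where r: "i = n r" by blast
    have "n r < n (Suc k)" using r i add.prems by simp
    then have "r \<le> k" using n by (simp add: strict_mono_less)
    then have "i \<le> n k" using r n by (simp add: strict_mono_less_eq)
    then have "size m * n k < j - i" "j - i < n (Suc k)" using add.prems by auto
    then show ?thesis by (simp add: add.IH)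
  qed (simp add: lacunary_nth_eq_0)
  then show ?case by (simp add: fps_monomial_def fps_mult_nth)
qed (simp add: fps_monomial_def)

text \<open>The order \<open>size m * n k\<close> arises only when every factor contributes
  \<open>n k\<close>: a smaller exponent leaves the other factors an order inside their gap.\<close>

lemma fps_monomial_lacunary_nth:
  fixes a :: "'v \<Rightarrow> nat \<Rightarrow> 'a::comm_ring_1"
  assumes n: "strict_mono n" and "size m * n k < n (Suc k)"
  shows "fps_nth (fps_monomial (\<lambda>x. lacunary n (a x)) m) (size m * n k) =
    prod_mset (image_mset (\<lambda>x. a x k) m)"
  using assms(2)
proof (induction m)
  case (add x m)
  let ?M = "fps_monomial (\<lambda>x. lacunary n (a x)) m" and ?j = "Suc (size m) * n k"
  have lt: "size m * n k < n (Suc k)" using add.prems by simp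
  have "fps_nth (lacunary n (a x)) i * fps_nth ?M (?j - i) =
      (if i = n k then a x k * prod_mset (image_mset (\<lambda>x. a x k) m) else 0)" if i: "i \<le> ?j" for i
  proof (cases "i \<in> range n")
    case True
    then obtain r where r: "i = n r" by blast
    have "n r < n (Suc k)" using r i add.prems by simp
    then have "r \<le> k" using n by (simp add: strict_mono_less)
    show ?thesis
    proof (cases "r = k")
      case True
      then show ?thesis using r n add.IH[OF lt] by (simp add: lacunary_nth_range)
    next
      case False
      then have "i < n k" using \<open>r \<le> k\<close> r n by (simp add: strict_mono_less)
      moreover have "?j - i < n (Suc k)" using add.prems by simp
      ultimately show ?thesis
        by (subst fps_monomial_lacunary_nth_eq_0[OF n, of _ k]) auto
    qed
  qed (auto simp: lacunary_nth_eq_0)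
  then have "(\<Sum>i=0..?j. fps_nth (lacunary n (a x)) i * fps_nth ?M (?j - i)) =
      (\<Sum>i=0..?j. if i = n k then a x k * prod_mset (image_mset (\<lambda>x. a x k) m) else 0)"
    by (intro sum.cong) auto
  also have "\<dots> = a x k * prod_mset (image_mset (\<lambda>x. a x k) m)"
    by simp
  finally show ?case by (simp add: fps_monomial_def fps_mult_nth)
qed (simp add: fps_monomial_def)

section \<open>Algebras generated by a family of series\<close>

interpretation fps_vs: vector_space "\<lambda>c (F :: complex fps). fps_const c * F"
  by unfold_locales (simp_all add: algebra_simps fps_const_add[symmetric] fps_const_mult[symmetric]
      del: fps_const_add fps_const_mult)

lemma fps_algebra_span:
  assumes B: "\<And>F G. F \<in> B \<Longrightarrow> G \<in> B \<Longrightarrow> F * G \<in> B"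
  shows "fps_algebra (fps_vs.span B)"
proof -
  have left: "F * G \<in> fps_vs.span B" if F: "F \<in> B" and G: "G \<in> fps_vs.span B" for F G
    using G
  proof (induction rule: fps_vs.span_induct_alt)
    case base
    then show ?case by (simp add: fps_vs.span_zero)
  next
    case (step c x y)
    have "F * (fps_const c * x + y) = fps_const c * (F * x) + F * y" by (simp add: algebra_simps)
    then show ?case
      using step B[OF F] fps_vs.span_add fps_vs.span_scale fps_vs.span_base by metis
  qed
  have "F * G \<in> fps_vs.span B" if F: "F \<in> fps_vs.span B" and G: "G \<in> fps_vs.span B" for F G
    using F
  proof (induction rule: fps_vs.span_induct_alt)
    case base
    then show ?case by (simp add: fps_vs.span_zero)
  next
    case (step c x y)
    have "(fps_const c * x + y) * G = fps_const c * (x * G) + y * G" by (simp add: algebra_simps)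
    then show ?case
      using step left G by (auto intro: fps_vs.span_add fps_vs.span_scale)
  qed
  then show ?thesis
    unfolding fps_algebra_def
    using fps_vs.span_zero fps_vs.span_add fps_vs.span_scale by blast
qed

lemma fps_algebra_hull: "fps_algebra (fps_algebra hull S)"
  by (rule hull_in) (auto simp: fps_algebra_def)

text \<open>The span of the monomials with at least one factor contains the generators and is closed
  under products. The monomial \<open>{#}\<close> is left out because the algebras need not have a
  unit.\<close>

lemma fps_algebra_hull_representation:
  assumes "G \<in> fps_algebra hull (F ` A)"
  obtains T c where "finite T" "\<And>m. m \<in> T \<Longrightarrow> m \<noteq> {#} \<and> set_mset m \<subseteq> A \<and> c m \<noteq> 0"
    "G = (\<Sum>m\<in>T. fps_const (c m) * fps_monomial F m)"
proof -
  define Ms where "Ms = {m. m \<noteq> {#} \<and> set_mset m \<subseteq> A}"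
  have "fps_algebra hull (F ` A) \<subseteq> fps_vs.span (fps_monomial F ` Ms)"
  proof (rule hull_minimal)
    have "F x \<in> fps_monomial F ` Ms" if "x \<in> A" for x
      using that by (intro image_eqI[of _ _ "{#x#}"]) (auto simp: fps_monomial_def Ms_def)
    then show "F ` A \<subseteq> fps_vs.span (fps_monomial F ` Ms)"
      by (auto intro: fps_vs.span_base)
    show "fps_algebra (fps_vs.span (fps_monomial F ` Ms))"
    proof (rule fps_algebra_span)
      fix H K assume "H \<in> fps_monomial F ` Ms" "K \<in> fps_monomial F ` Ms"
      then obtain m m' where m: "m \<in> Ms" "m' \<in> Ms" "H = fps_monomial F m" "K = fps_monomial F m'"
        by blast
      then have "H * K = fps_monomial F (m + m')" "m + m' \<in> Ms"
        by (auto simp: fps_monomial_def Ms_def)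
      then show "H * K \<in> fps_monomial F ` Ms" by blast
    qed
  qed
  then have "G \<in> fps_vs.span (fps_monomial F ` Ms)" using assms by blast
  then obtain t r where t: "finite t" "t \<subseteq> fps_monomial F ` Ms" "G = (\<Sum>H\<in>t. fps_const (r H) * H)"
    unfolding fps_vs.span_explicit by blast
  \<comment> \<open>Different multisets might give the same series, as independence is not known
    here; one multiset is chosen for each series in \<open>t\<close>.\<close>
  obtain U where U: "U \<subseteq> Ms" "inj_on (fps_monomial F) U" "t = fps_monomial F ` U"
    using t(2) unfolding subset_image_inj by blast
  have fU: "finite U" using t(1) U by (simp add: finite_image_iff)
  define c where "c m = r (fps_monomial F m)" for m
  define T where "T = {m \<in> U. c m \<noteq> 0}"
  have "G = (\<Sum>m\<in>U. fps_const (c m) * fps_monomial F m)"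
    by (simp add: t(3) U(3) sum.reindex[OF U(2)] c_def)
  also have "\<dots> = (\<Sum>m\<in>T. fps_const (c m) * fps_monomial F m)"
    by (rule sum.mono_neutral_right[OF fU]) (auto simp: T_def)
  finally have G: "G = (\<Sum>m\<in>T. fps_const (c m) * fps_monomial F m)" .
  show ?thesis
    by (rule that[OF _ _ G]) (use fU U(1) in \<open>auto simp: T_def Ms_def\<close>)
qed


section \<open>The image of the Borel map\<close>

text \<open>Under this condition, if the derivatives of orders from \<open>K\<close> to \<open>n - 1\<close> vanish at \<open>0\<close>, Bang's
  estimate bounds the derivative of order \<open>K\<close> on \<open>[0, 1]\<close> independently of \<open>K\<close>.\<close>

definition long_gap :: "(nat \<Rightarrow> real) \<Rightarrow> nat \<Rightarrow> nat \<Rightarrow> bool" where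
  "long_gap M K n \<longleftrightarrow> (\<exists>N\<ge>K. N \<le> n \<and> exp (real K - real N) * M K \<le> 1 \<and>
     exp 1 \<le> (\<Sum>i\<in>{N..<n}. M i / M (Suc i)))"

text \<open>First \<open>N\<close> is taken so large that the exponential outweighs
  \<open>M K\<close>; the divergent series then has blocks starting at \<open>N\<close> with sum at
  least \<open>exp 1\<close>.\<close>

lemma eventually_long_gap:
  assumes pos: "\<And>j. M j > 0" and div: "\<not> summable (\<lambda>i. M i / M (Suc i))"
  shows "\<forall>\<^sub>F n in sequentially. long_gap M K n"
proof -
  have nn: "0 \<le> M i / M (Suc i)" for i using pos[of i] pos[of "Suc i"] by simp
  define N where "N = K + nat \<lceil>M K\<rceil>"
  have "M K \<le> real (nat \<lceil>M K\<rceil>)" by (rule real_nat_ceiling_ge)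
  also have "\<dots> \<le> exp (real (nat \<lceil>M K\<rceil>))" using exp_ge_add_one_self[of "real (nat \<lceil>M K\<rceil>)"] by linarith
  finally have N: "exp (real K - real N) * M K \<le> 1"
    by (simp add: N_def exp_minus field_simps)
  have "\<exists>n0. (\<Sum>i<N. M i / M (Suc i)) + exp 1 < (\<Sum>i<n0. M i / M (Suc i))"
    using div summableI_nonneg_bounded[OF nn] by (meson not_le)
  then obtain n0 where n0: "(\<Sum>i<N. M i / M (Suc i)) + exp 1 < (\<Sum>i<n0. M i / M (Suc i))" by blast
  have "long_gap M K n" if n: "n \<ge> max n0 N" for n
  proof -
    have "(\<Sum>i<n0. M i / M (Suc i)) \<le> (\<Sum>i<n. M i / M (Suc i))"
      using n nn by (intro sum_mono2) auto
    moreover have "(\<Sum>i<n. M i / M (Suc i)) = (\<Sum>i<N. M i / M (Suc i)) + (\<Sum>i\<in>{N..<n}. M i / M (Suc i))"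
      using n by (simp add: lessThan_atLeast0 sum.atLeastLessThan_concat)
    ultimately show ?thesis
      using n0 n N unfolding long_gap_def by (intro exI[of _ N]) (auto simp: N_def)
  qed
  then show ?thesis unfolding eventually_sequentially by blast
qed

text \<open>Bang's estimate bounds the derivative of order \<open>K\<close> by \<open>C\<close>, so
  the function differs by at most \<open>C\<close> from its Taylor polynomial of degree below
  \<open>K\<close>. The vanishing coefficients reduce this polynomial to degree at most
  \<open>m\<close>, and \<open>lead_coeff_bound\<close> applies to it. The resulting bound involves
  \<open>M\<close> only through \<open>M 0\<close>.\<close>

lemma coeff_bound_before_long_gap:
  fixes Df :: "nat \<Rightarrow> real \<Rightarrow> complex" and M :: "nat \<Rightarrow> real"
  assumes pos: "\<And>j. M j > 0"
    and lc: "\<And>i k. i \<le> k \<Longrightarrow> M (Suc i) / M i \<le> M (Suc k) / M k"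
    and C: "C \<ge> 0" and \<delta>: "0 < \<delta>" "\<delta> \<le> 1"
    and Df: "\<And>m t. t \<in> {0..\<delta>} \<Longrightarrow>
      (Df m has_vector_derivative Df (Suc m) t) (at t within {0..\<delta>})"
    and bd: "\<And>j t. t \<in> {0..\<delta>} \<Longrightarrow> norm (Df j t) \<le> C * M j"
    and gap: "long_gap M K n" and mK: "m < K"
    and van: "\<And>j. m < j \<Longrightarrow> j < n \<Longrightarrow> Df j 0 = 0"
  shows "norm (Df m 0 / fact m) \<le> C * (M 0 + 1) * (2 * exp 1 / \<delta>) ^ m"
proof -
  obtain N where N: "N \<ge> K" "N \<le> n" "exp (real K - real N) * M K \<le> 1"
    "exp 1 \<le> (\<Sum>i\<in>{N..<n}. M i / M (Suc i))"
    using gap unfolding long_gap_def by blast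
  have DK: "norm (Df K t) \<le> C" if t: "t \<in> {0..\<delta>}" for t
  proof -
    have "t * exp 1 \<le> 1 * exp 1" using t \<delta> by (intro mult_right_mono) auto
    then have "t * exp 1 \<le> (\<Sum>i\<in>{N..<n}. M i / M (Suc i))" using N(4) by linarith
    then have "norm (Df K t) \<le> C * exp (real K - real N) * M K"
      using mK van
      by (intro Bang_estimate[where Df = Df and \<delta> = \<delta> and n = n and K = K,
            OF pos lc C Df bd _ N(2) t]) auto
    also have "\<dots> = C * (exp (real K - real N) * M K)" by simp
    also have "\<dots> \<le> C * 1" using C N(3) by (intro mult_left_mono)
    finally show ?thesis by simp
  qed
  define P where "P = (\<Sum>i\<le>m. monom (Df i 0 / fact i) i)"
  have "norm (coeff P m) \<le> (C * M 0 + C) * (2 * exp 1 / \<delta>) ^ m"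
  proof (rule lead_coeff_bound[OF \<delta>(1)])
    show "degree P \<le> m"
      unfolding P_def by (intro degree_sum_le) (auto intro: order_trans[OF degree_monom_le])
    fix x :: real assume x: "0 \<le> x" "x \<le> \<delta>"
    have sub: "{0..x} \<subseteq> {0..\<delta>}" using x by auto
    have "norm (Df 0 x - (\<Sum>i<K. ((x - 0) ^ i / fact i) *\<^sub>R Df i 0)) \<le> (x - 0) ^ K / fact K * C"
    proof (rule Taylor_remainder_norm)
      fix i t assume "t \<in> {0..x}"
      then show "(Df i has_vector_derivative Df (Suc i) t) (at t within {0..x})"
        using sub by (intro has_vector_derivative_within_subset[OF Df sub]) auto
    qed (use mK x sub DK in auto)
    also have "\<dots> \<le> 1 * C"
    proof (intro mult_right_mono[OF _ C])
      have "x ^ K \<le> 1" using x \<delta> by (intro power_le_one) auto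
      also have "1 \<le> (fact K :: real)" by simp
      finally show "(x - 0) ^ K / fact K \<le> 1" by simp
    qed
    finally have 1: "norm (Df 0 x - (\<Sum>i<K. (x ^ i / fact i) *\<^sub>R Df i 0)) \<le> C" by simp
    have "(\<Sum>i<K. (x ^ i / fact i) *\<^sub>R Df i 0) = (\<Sum>i\<le>m. (x ^ i / fact i) *\<^sub>R Df i 0)"
      using mK van N(1,2) by (intro sum.mono_neutral_right) auto
    also have "\<dots> = poly P (of_real x)"
      unfolding P_def poly_sum poly_monom by (intro sum.cong) (auto simp: scaleR_conv_of_real)
    finally have "norm (Df 0 x - poly P (of_real x)) \<le> C" using 1 by simp
    moreover have "norm (Df 0 x) \<le> C * M 0" using x by (intro bd) auto
    ultimately show "norm (poly P (of_real x)) \<le> C * M 0 + C"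
      using norm_triangle_ineq4[of "Df 0 x" "Df 0 x - poly P (of_real x)"] by simp
  qed
  moreover have "coeff P m = Df m 0 / fact m"
    unfolding P_def coeff_sum coeff_monom by simp
  ultimately show ?thesis by (simp add: distrib_left)
qed

section \<open>Choice of the exponents\<close>

text \<open>In \<open>weight_seq_lower\<close> the point \<open>t\<close> is taken with
  \<open>\<omega> t\<close> small compared with \<open>t\<close>, and \<open>n\<close> is the
  integer part of \<open>t / q\<close>. Then \<open>t ^ n\<close> is at least
  \<open>(q * n) ^ n\<close>, and \<open>exp (- (\<omega> t / l))\<close> is at least
  \<open>exp (- n)\<close>.\<close>

lemma frequently_weight_seq_ge:
  assumes W: "\<omega> \<in> weight_class" and l: "l > 0"
    and small: "\<And>\<epsilon>. \<epsilon> > 0 \<Longrightarrow> \<exists>\<^sub>F t in at_top. \<omega> t \<le> \<epsilon> * t" and B: "B \<ge> 0"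
  shows "\<exists>\<^sub>F n in sequentially. B ^ n * fact n \<le> weight_seq \<omega> l n"
  unfolding frequently_sequentially
proof
  fix n0 :: nat
  \<comment> \<open>\<open>B + 1\<close> instead of \<open>B\<close> keeps \<open>q\<close> positive
    for \<open>B = 0\<close>; the factor e pays for the loss \<open>exp (- n)\<close>.\<close>
  define q where "q = exp 1 * (B + 1)"
  have q: "q > 0" using B by (simp add: q_def)
  have "\<exists>\<^sub>F t in at_top. \<omega> t \<le> l / (2 * q) * t" using l q by (intro small) simp
  \<comment> \<open>The summand 2 gives \<open>s \<ge> 2\<close>, whence
    \<open>s / 2 \<le> n\<close>.\<close>
  then have "\<exists>\<^sub>F t in at_top. \<omega> t \<le> l / (2 * q) * t \<and> t \<ge> max 1 (q * (n0 + 2))"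
    by (rule frequently_eventually_frequently) (rule eventually_ge_at_top)
  then obtain t where t: "\<omega> t \<le> l / (2 * q) * t" "t \<ge> 1" "t \<ge> q * (n0 + 2)"
    by (auto dest!: frequently_ex)
  define s where "s = t / q"
  define n where "n = nat \<lfloor>s\<rfloor>"
  have s: "s \<ge> n0 + 2" using t(3) q by (simp add: s_def field_simps)
  have n: "real n \<le> s" "s \<le> real n + 1"
    using s unfolding n_def by (simp, linarith)
  have "n \<ge> n0" using n s by linarith
  moreover have "B ^ n * fact n \<le> weight_seq \<omega> l n"
  proof -
    have "\<omega> t \<le> l * (s / 2)" using t(1) by (simp add: s_def)
    also have "\<dots> \<le> l * real n" using l n s by (intro mult_left_mono) auto
    finally have "\<omega> t / l \<le> real n" using l by (simp add: field_simps)
    then have e: "exp (- real n) \<le> exp (- (\<omega> t / l))" by simp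
    have "(B + 1) * real n * exp 1 \<le> t"
    proof -
      have "q * real n \<le> q * s" using n q by (intro mult_left_mono) auto
      then show ?thesis using q by (simp add: s_def) (simp add: q_def mult_ac)
    qed
    then have "((B + 1) * real n * exp 1) ^ n * exp (- real n) \<le> t ^ n * exp (- (\<omega> t / l))"
      using B e t(2) by (intro mult_mono power_mono) auto
    also have "\<dots> \<le> weight_seq \<omega> l n" by (rule weight_seq_lower[OF W l t(2)])
    also have "((B + 1) * real n * exp 1) ^ n * exp (- real n) = (B + 1) ^ n * real n ^ n"
      by (simp add: power_mult_distrib exp_of_nat_mult[symmetric] mult_exp_exp)
    finally have "(B + 1) ^ n * real n ^ n \<le> weight_seq \<omega> l n" .
    moreover have "B ^ n * fact n \<le> (B + 1) ^ n * real n ^ n"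
      using B fact_le_power[of n, where 'a = real] by (intro mult_mono power_mono) auto
    ultimately show ?thesis by linarith
  qed
  ultimately show "\<exists>n\<ge>n0. B ^ n * fact n \<le> weight_seq \<omega> l n" by blast
qed

text \<open>Recursive choice: the gap condition on the next exponent holds eventually and the growth
  condition frequently, so both can be met together. The factor \<open>Suc k\<close> serves all
  degrees up to \<open>Suc k\<close> at once, and the parameter \<open>Suc k\<close> of the weight
  sequence exceeds every fixed Roumieu parameter from some \<open>k\<close> on.\<close>

lemma ex_lacunary_exponents:
  assumes S: "\<sigma> \<in> weight_class" "quasianalytic \<sigma>" and W: "\<omega> \<in> weight_class"
    and small: "\<And>\<epsilon>. \<epsilon> > 0 \<Longrightarrow> \<exists>\<^sub>F t in at_top. \<omega> t \<le> \<epsilon> * t"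
    and l: "\<And>k. l k > 0"
  obtains n :: "nat \<Rightarrow> nat" where "0 < n 0" "\<And>k. Suc k * n k < n (Suc k)"
    "\<And>k. long_gap (weight_seq \<sigma> (Suc k)) (Suc (Suc k * n k)) (n (Suc k))"
    "\<And>k. real k ^ n k * fact (n k) \<le> weight_seq \<omega> (l k) (n k)"
proof -
  define P where "P k n \<longleftrightarrow> 0 < n \<and> real k ^ n * fact n \<le> weight_seq \<omega> (l k) n" for k n
  define Q where "Q k n n' \<longleftrightarrow> Suc k * n < n' \<and>
    long_gap (weight_seq \<sigma> (Suc k)) (Suc (Suc k * n)) n'" for k n n'
  have freq: "\<exists>\<^sub>F n in sequentially. real k ^ n * fact n \<le> weight_seq \<omega> (l k) n" for k
    by (intro frequently_weight_seq_ge W l small) auto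
  have "\<exists>n. \<forall>k. P k (n k) \<and> Q k (n k) (n (Suc k))"
  proof (rule dependent_nat_choice)
    have "\<exists>\<^sub>F n in sequentially. 0 < n \<and> real 0 ^ n * fact n \<le> weight_seq \<omega> (l 0) n"
      by (intro frequently_eventually_conj freq eventually_gt_at_top)
    then show "\<exists>n. P 0 n" unfolding P_def using frequently_ex by fastforce
  next
    fix n k
    have "\<forall>\<^sub>F n' in sequentially. long_gap (weight_seq \<sigma> (Suc k)) (Suc (Suc k * n)) n'"
      using quasianalytic_not_summable[OF S, of "real (Suc k)"]
      by (intro eventually_long_gap weight_seq_pos) auto
    then have "\<forall>\<^sub>F n' in sequentially. Suc k * n < n' \<and>
        long_gap (weight_seq \<sigma> (Suc k)) (Suc (Suc k * n)) n'"
      by (intro eventually_conj eventually_gt_at_top)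
    then have "\<exists>\<^sub>F n' in sequentially. (Suc k * n < n' \<and>
        long_gap (weight_seq \<sigma> (Suc k)) (Suc (Suc k * n)) n') \<and>
        real (Suc k) ^ n' * fact n' \<le> weight_seq \<omega> (l (Suc k)) n'"
      by (intro frequently_eventually_conj freq)
    then obtain n' where "real (Suc k) ^ n' * fact n' \<le> weight_seq \<omega> (l (Suc k)) n'"
       "Suc k * n < n'" "long_gap (weight_seq \<sigma> (Suc k)) (Suc (Suc k * n)) n'"
      using frequently_ex by blast
    then show "\<exists>n'. P (Suc k) n' \<and> Q k n n'"
      unfolding P_def Q_def by (intro exI[of _ n']) auto
  qed
  then obtain n where "\<And>k. P k (n k)" "\<And>k. Q k (n k) (n (Suc k))" by blast
  then show ?thesis by (intro that[of n]) (auto simp: P_def Q_def)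
qed

section \<open>Polynomials in the generators avoid the image\<close>

lemma prod_mset_image_scale:
  "prod_mset (image_mset (\<lambda>x. c * v x) m) = c ^ size m * prod_mset (image_mset v m)"
  for c :: "'a::comm_ring_1"
  by (induction m) (auto simp: mult_ac)

text \<open>\<open>d\<close> is the largest degree of a monomial. For \<open>k \<ge> d\<close>, at
  order \<open>d * n k\<close> the monomials of lower degree vanish, and those of degree
  \<open>d\<close> give \<open>k ^ (d * n k)\<close> times the leading form at the numbers
  \<open>1 / (1 + u k x)\<close>. A point where this form does not vanish is fixed; its pattern
  recurs for infinitely many \<open>k\<close> and provides \<open>\<kappa>\<close>.\<close>

lemma lacunary_polynomial_growth:
  fixes n :: "nat \<Rightarrow> nat" and u :: "nat \<Rightarrow> 'v \<Rightarrow> nat" and c :: "'v multiset \<Rightarrow> complex"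
  assumes n0: "0 < n 0" and n: "\<And>k. Suc k * n k < n (Suc k)"
    and u: "\<And>A w. finite A \<Longrightarrow> \<exists>\<^sub>\<infinity>k. \<forall>x\<in>A. u k x = w x"
    and T: "finite T" "T \<noteq> {}" "\<And>m. m \<in> T \<Longrightarrow> m \<noteq> {#} \<and> c m \<noteq> 0"
  defines "F \<equiv> \<lambda>x. lacunary n (\<lambda>k. of_real (real k ^ n k) * (1 / (1 + of_nat (u k x))))"
  defines "G \<equiv> (\<Sum>m\<in>T. fps_const (c m) * fps_monomial F m)"
  shows "\<exists>d\<ge>1. \<exists>\<kappa>>0. (\<forall>k\<ge>d. \<forall>j. d * n k < j \<longrightarrow> j < n (Suc k) \<longrightarrow> fps_nth G j = 0) \<and>
    (\<exists>\<^sub>\<infinity>k. norm (fps_nth G (d * n k)) \<ge> \<kappa> * real k ^ (d * n k))"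
proof -
  have lt: "n k < n (Suc k)" for k using n[of k] by simp
  then have mono: "strict_mono n" by (rule strict_monoI_Suc)
  have npos: "n k > 0" for k using n0 mono by (metis gr0I le0 le_zero_eq strict_mono_less_eq)
  define d where "d = Max (size ` T)"
  define U where "U = {m \<in> T. size m = d}"
  have dmax: "size m \<le> d" if "m \<in> T" for m using that T(1) by (simp add: d_def)
  have "d \<in> size ` T" unfolding d_def using T by (intro Max_in) auto
  then have U: "U \<noteq> {}" "finite U" "U \<subseteq> T" using T(1) by (auto simp: U_def)
  have d1: "d \<ge> 1"
  proof -
    obtain m where "m \<in> T" using T(2) by blast
    then have "size m \<ge> 1" using T(3)[of m] by (cases m) auto
    then show ?thesis using dmax[OF \<open>m \<in> T\<close>] by linarith
  qed
  have bd: "d * n k < n (Suc k)" if "k \<ge> d" for k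
    using n[of k] that mult_le_mono1[of d "Suc k" "n k"] by linarith
  have van: "fps_nth G j = 0" if "k \<ge> d" "d * n k < j" "j < n (Suc k)" for k j
  proof -
    have "fps_nth (fps_monomial F m) j = 0" if "m \<in> T" for m
      unfolding F_def
      using mult_le_mono1[OF dmax[OF that], of "n k"] \<open>d * n k < j\<close> \<open>j < n (Suc k)\<close>
      by (intro fps_monomial_lacunary_nth_eq_0[OF mono, of _ k]) linarith+
    then show ?thesis by (simp add: G_def fps_sum_nth)
  qed
  \<comment> \<open>Infinitely many values of modulus at most 1, so that the coefficients of the
    generators do not exceed \<open>k ^ n k\<close> in modulus.\<close>
  define X where "X = range (\<lambda>i. 1 / (1 + of_nat i) :: complex)"
  have "infinite X"
    unfolding X_def
  proof (rule range_inj_infinite, rule injI)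
    fix i j :: nat assume "1 / (1 + of_nat i) = 1 / (1 + of_nat j :: complex)"
    then have "(of_nat (Suc i) :: complex) = of_nat (Suc j)" by simp
    then show "i = j" unfolding of_nat_eq_iff by simp
  qed
  define V where "V = (\<Union>m\<in>U. set_mset m)"
  have "\<exists>v. (\<forall>x. v x \<in> X) \<and> (\<Sum>m\<in>U. c m * prod_mset (image_mset v m)) \<noteq> 0"
    using U T \<open>infinite X\<close> by (intro ex_nonzero_evaluation[of V]) (auto simp: V_def)
  then obtain v where v: "\<And>x. v x \<in> X" "(\<Sum>m\<in>U. c m * prod_mset (image_mset v m)) \<noteq> 0" by blast
  define w where "w x = (SOME i. v x = 1 / (1 + of_nat i))" for x
  have w: "v x = 1 / (1 + of_nat (w x))" for x
  proof -
    have "\<exists>i. v x = 1 / (1 + of_nat i)" using v(1)[of x] unfolding X_def by (rule rangeE) (rule exI)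
    then show ?thesis unfolding w_def by (rule someI_ex)
  qed
  define \<kappa> where "\<kappa> = norm (\<Sum>m\<in>U. c m * prod_mset (image_mset v m))"
  have coeff: "norm (fps_nth G (d * n k)) \<ge> \<kappa> * real k ^ (d * n k)"
    if k: "k \<ge> d" and uw: "\<forall>x\<in>V. u k x = w x" for k
  proof -
    have "fps_nth (fps_monomial F m) (d * n k) = 0" if "m \<in> T - U" for m
    proof -
      have "size m < d" using that dmax[of m] by (auto simp: U_def)
      then show ?thesis
        unfolding F_def using bd[OF k] npos
        by (intro fps_monomial_lacunary_nth_eq_0[OF mono, of _ k]) auto
    qed
    then have "fps_nth G (d * n k) = (\<Sum>m\<in>U. c m * fps_nth (fps_monomial F m) (d * n k))"
      unfolding G_def fps_sum_nth fps_mult_left_const_nth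
      using T(1) U by (intro sum.mono_neutral_right) auto
    also have "\<dots> = (\<Sum>m\<in>U. of_real (real k ^ n k) ^ d * (c m * prod_mset (image_mset v m)))"
    proof (rule sum.cong[OF refl])
      fix m assume m: "m \<in> U"
      have "fps_nth (fps_monomial F m) (size m * n k) =
          prod_mset (image_mset (\<lambda>x. of_real (real k ^ n k) * (1 / (1 + of_nat (u k x)))) m)"
        unfolding F_def using m bd[OF k]
        by (intro fps_monomial_lacunary_nth[OF mono]) (auto simp: U_def)
      also have "image_mset (\<lambda>x. of_real (real k ^ n k) * (1 / (1 + of_nat (u k x)))) m =
          image_mset (\<lambda>x. of_real (real k ^ n k) * v x) m"
        using m uw by (intro image_mset_cong) (auto simp: V_def w)
      finally show "c m * fps_nth (fps_monomial F m) (d * n k) =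
          of_real (real k ^ n k) ^ d * (c m * prod_mset (image_mset v m))"
        using m by (simp add: U_def prod_mset_image_scale)
    qed
    also have "\<dots> = of_real (real k ^ n k) ^ d * (\<Sum>m\<in>U. c m * prod_mset (image_mset v m))"
      by (simp add: sum_distrib_left)
    finally show ?thesis
      by (simp add: \<kappa>_def norm_mult norm_power power_mult[symmetric] mult.commute)
  qed
  have "finite V" using U by (simp add: V_def)
  then have "\<exists>\<^sub>\<infinity>k. \<forall>x\<in>V. u k x = w x" by (rule u)
  then have "\<exists>\<^sub>\<infinity>k. k \<ge> d \<and> (\<forall>x\<in>V. u k x = w x)"
    by (simp add: INFM_nat_le) (metis le_trans nat_le_linear)
  then have "\<exists>\<^sub>\<infinity>k. norm (fps_nth G (d * n k)) \<ge> \<kappa> * real k ^ (d * n k)"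
    by (rule INFM_mono) (use coeff in auto)
  moreover have "\<kappa> > 0" using v(2) by (simp add: \<kappa>_def)
  ultimately show ?thesis using d1 van by blast
qed

text \<open>For a function with Taylor series \<open>G\<close>,
  \<open>coeff_bound_before_long_gap\<close> bounds the coefficients at \<open>d * n k\<close>
  geometrically with a ratio \<open>A\<close> independent of \<open>k\<close>, against
  \<open>large\<close>.\<close>

lemma not_borel_image:
  assumes S: "\<sigma> \<in> weight_class" and n0: "0 < n 0" and n: "\<And>k. Suc k * n k < n (Suc k)"
    and gap: "\<And>k. long_gap (weight_seq \<sigma> (Suc k)) (Suc (Suc k * n k)) (n (Suc k))"
    and d: "d \<ge> 1" and \<kappa>: "\<kappa> > 0"
    and van: "\<And>k j. k \<ge> d \<Longrightarrow> d * n k < j \<Longrightarrow> j < n (Suc k) \<Longrightarrow> fps_nth G j = 0"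
    and large: "\<exists>\<^sub>\<infinity>k. norm (fps_nth G (d * n k)) \<ge> \<kappa> * real k ^ (d * n k)"
  shows "G \<notin> borel_map ` E0_Roumieu \<sigma>"
proof
  assume "G \<in> borel_map ` E0_Roumieu \<sigma>"
  then obtain r f where r: "r \<ge> (1::nat)" and f: "f \<in> E_Roumieu \<sigma> {- (1 / real r) <..< 1 / real r}"
    and G: "G = taylor_series0 f"
    by (auto simp: E0_Roumieu_def borel_map_germ0)
  define \<delta> where "\<delta> = 1 / (2 * real r)"
  have \<delta>: "0 < \<delta>" "\<delta> \<le> 1" "\<delta> < 1 / real r" using r by (auto simp: \<delta>_def field_simps)
  have sub: "{0..\<delta>} \<subseteq> {- (1 / real r) <..< 1 / real r}"
  proof
    fix x assume "x \<in> {0..\<delta>}"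
    moreover have "- (1 / real r) < 0" using r by simp
    ultimately show "x \<in> {- (1 / real r) <..< 1 / real r}"
      using \<delta>(3) by (simp only: atLeastAtMost_iff greaterThanLessThan_iff) linarith
  qed
  obtain l where l: "l > 0" "deriv_bound \<sigma> l {0..\<delta>} f"
    using f sub unfolding E_Roumieu_def by (auto dest: spec[of _ "{0..\<delta>}"])
  then obtain C' where C': "\<And>j x. x \<in> {0..\<delta>} \<Longrightarrow> norm (nth_deriv j f x) / weight_seq \<sigma> l j \<le> C'"
    unfolding deriv_bound_def bdd_above_def by force
  define C where "C = max 0 C'"
  have C: "C \<ge> 0" "norm (nth_deriv j f x) \<le> C * weight_seq \<sigma> l j" if "x \<in> {0..\<delta>}" for j x
    using C'[OF that, of j]
    by (auto simp: C_def pos_divide_le_eq[OF weight_seq_pos] intro!: less_imp_le[OF weight_seq_pos]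
        order_trans[OF _ mult_right_mono[of C' "max 0 C'" "weight_seq \<sigma> l j"]])
  have C0: "C \<ge> 0" by (simp add: C_def)
  have deriv: "(nth_deriv m f has_vector_derivative nth_deriv (Suc m) f t) (at t within {0..\<delta>})"
    if "t \<in> {0..\<delta>}" for m t
  proof -
    have "nth_deriv m f differentiable (at t)"
      using f that sub unfolding E_Roumieu_def smooth_on_def by blast
    then have "(nth_deriv m f has_vector_derivative vector_derivative (nth_deriv m f) (at t)) (at t)"
      by (simp add: vector_derivative_works)
    then show ?thesis
      by (simp add: nth_deriv_def has_vector_derivative_at_within)
  qed
  define A where "A = 2 * exp 1 / \<delta>"
  have A: "A > 0" using \<delta> by (simp add: A_def)
  \<comment> \<open>The thresholds for \<open>k\<close>: \<open>l\<close>, so that the bound on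
    \<open>f\<close> carries over to the parameter \<open>Suc k\<close>; \<open>A\<close>, so that
    \<open>k / A \<ge> 1\<close>; the last term for the final contradiction.\<close>
  obtain b :: nat where b: "real b \<ge> max (max l A) (2 * C * A / \<kappa>)" by (meson real_arch_simple)
  obtain k where k: "k > max b d" "norm (fps_nth G (d * n k)) \<ge> \<kappa> * real k ^ (d * n k)"
    using large unfolding INFM_nat by blast
  have kl: "l \<le> real (Suc k)" "A \<le> real k" "2 * C * A / \<kappa> < real k" using k b by auto
  have "norm (nth_deriv (d * n k) f 0 / fact (d * n k)) \<le>
      C * (weight_seq \<sigma> (Suc k) 0 + 1) * (2 * exp 1 / \<delta>) ^ (d * n k)"
  proof (rule coeff_bound_before_long_gap[where Df = "\<lambda>j. nth_deriv j f"])
    show "weight_seq \<sigma> (Suc k) (Suc i) / weight_seq \<sigma> (Suc k) i \<le>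
        weight_seq \<sigma> (Suc k) (Suc j) / weight_seq \<sigma> (Suc k) j" if "i \<le> j" for i j
      using that by (intro weight_seq_quotient_mono S) auto
    show "norm (nth_deriv j f t) \<le> C * weight_seq \<sigma> (Suc k) j" if "t \<in> {0..\<delta>}" for j t
      using C(2)[OF that, of j] mult_left_mono[OF weight_seq_mono[OF S l(1) kl(1), of j] C0] by linarith
    show "long_gap (weight_seq \<sigma> (Suc k)) (Suc (Suc k * n k)) (n (Suc k))" by (rule gap)
    have "d * n k \<le> Suc k * n k" using k(1) by (intro mult_le_mono1) simp
    then show "d * n k < Suc (Suc k * n k)" by simp
    fix j assume "d * n k < j" "j < n (Suc k)"
    then have "fps_nth G j = 0" using k(1) by (intro van[of k]) auto
    then show "nth_deriv j f 0 = 0" by (simp add: G taylor_series0_def)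
  qed (use \<delta> C0 deriv weight_seq_pos in auto)
  \<comment> \<open>\<open>weight_seq\<close> is 1 at order 0 for every parameter, so the factor
    \<open>M 0 + 1\<close> is 2 for all \<open>k\<close>.\<close>
  then have "norm (fps_nth G (d * n k)) \<le> 2 * C * A ^ (d * n k)"
    by (simp add: G taylor_series0_def A_def weight_seq_zero[OF S])
  then have "\<kappa> * real k ^ (d * n k) \<le> 2 * C * A ^ (d * n k)" using k(2) by linarith
  then have 1: "\<kappa> * (real k / A) ^ (d * n k) \<le> 2 * C"
    using A by (simp add: power_divide field_simps)
  have "n k > 0"
  proof (cases k)
    case (Suc i)
    then show ?thesis using n[of i] by simp
  qed (use n0 in simp)
  then have "(real k / A) ^ 1 \<le> (real k / A) ^ (d * n k)"
    using d kl(2) A by (intro power_increasing) (auto simp: Suc_le_eq)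
  then have "\<kappa> * (real k / A) \<le> 2 * C" using 1 \<kappa> mult_left_mono[of "real k / A" "(real k / A) ^ (d * n k)" \<kappa>] by simp
  then show False using kl(3) A \<kappa> by (simp add: field_simps)
qed

section \<open>Membership of the generators and algebrability\<close>

text \<open>From index \<open>K\<close> on the bound follows from monotonicity in the parameter; the
  finitely many earlier quotients are absorbed into \<open>M\<close>.\<close>

lemma lacunary_coeff_bound:
  fixes a :: "nat \<Rightarrow> complex"
  assumes W: "\<omega> \<in> weight_class" and n: "strict_mono n"
    and l: "\<And>k. l k > 0" "\<And>k. k \<ge> K \<Longrightarrow> l k \<le> l'"
    and a: "\<And>k. norm (a k) * fact (n k) \<le> weight_seq \<omega> (l k) (n k)"
  shows "coeff_bound \<omega> l' (lacunary n a)"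
proof -
  define R where "R k = weight_seq \<omega> (l k) (n k) / weight_seq \<omega> l' (n k)" for k
  have R: "R k \<ge> 0" for k by (simp add: R_def less_imp_le weight_seq_pos)
  define M where "M = 1 + (\<Sum>k<K. R k)"
  have M: "M \<ge> 1" using R by (simp add: M_def sum_nonneg)
  have RM: "R k \<le> M" for k
  proof (cases "k < K")
    case True
    then have "R k \<le> (\<Sum>k<K. R k)" using R by (intro member_le_sum) auto
    then show ?thesis by (simp add: M_def)
  next
    case False
    then have "R k \<le> 1"
      using weight_seq_mono[OF W l(1) l(2), of k "n k"] weight_seq_pos[of \<omega> l' "n k"] by (simp add: R_def)
    then show ?thesis using M by simp
  qed
  have "norm (fps_nth (lacunary n a) j) * fact j \<le> M * weight_seq \<omega> l' j" for j
  proof (cases "j \<in> range n")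
    case True
    then obtain k where k: "j = n k" by blast
    have "norm (a k) * fact (n k) \<le> R k * weight_seq \<omega> l' (n k)"
      using a[of k] weight_seq_pos[of \<omega> l' "n k"] by (simp add: R_def)
    also have "\<dots> \<le> M * weight_seq \<omega> l' (n k)"
      using RM by (intro mult_right_mono less_imp_le[OF weight_seq_pos])
    finally show ?thesis by (simp add: k lacunary_nth_range[OF n])
  next
    case False
    then show ?thesis using M weight_seq_pos[of \<omega> l' j] by (simp add: lacunary_nth_eq_0)
  qed
  then show ?thesis unfolding coeff_bound_iff using M by (intro exI[of _ M]) auto
qed

text \<open>\<open>free\<close> acts in two ways: exclusion from \<open>I\<close> keeps the nonzero
  elements of the generated algebra outside \<open>I\<close>, and exclusion of 0 makes the
  generators algebraically independent, so that none lies in the algebra generated by the others.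
  The latter gives minimality and the injectivity of \<open>F\<close>, hence the
  cardinality.\<close>

lemma algebrable_inI:
  fixes F :: "'v \<Rightarrow> complex fps"
  assumes A: "fps_algebra A" and F: "\<And>x. F x \<in> A"
    and free: "\<And>T c. finite T \<Longrightarrow> T \<noteq> {} \<Longrightarrow> (\<And>m. m \<in> T \<Longrightarrow> m \<noteq> {#} \<and> c m \<noteq> 0) \<Longrightarrow>
      (\<Sum>m\<in>T. fps_const (c m) * fps_monomial F m) \<notin> I \<union> {0}"
  shows "algebrable_in (UNIV :: 'v set) A (A - I)"
proof -
  define C where "C = fps_algebra hull (range F)"
  have CA: "C \<subseteq> A" unfolding C_def using F A by (intro hull_minimal) auto
  have CI: "G \<notin> I" if G: "G \<in> C" "G \<noteq> 0" for G
  proof -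
    obtain T c where T: "finite T" "\<And>m. m \<in> T \<Longrightarrow> m \<noteq> {#} \<and> set_mset m \<subseteq> UNIV \<and> c m \<noteq> 0"
      "G = (\<Sum>m\<in>T. fps_const (c m) * fps_monomial F m)"
      using fps_algebra_hull_representation[OF G(1)[unfolded C_def]] by blast
    have "T \<noteq> {}" using T(3) G(2) by auto
    then have "G \<notin> I \<union> {0}" unfolding T(3) using T(1,2) by (intro free) auto
    then show ?thesis by simp
  qed
  have indep: "F x \<notin> fps_algebra hull (F ` (- {x}))" for x
  proof
    assume x: "F x \<in> fps_algebra hull (F ` (- {x}))"
    obtain T c where T: "finite T" "\<And>m. m \<in> T \<Longrightarrow> m \<noteq> {#} \<and> set_mset m \<subseteq> - {x} \<and> c m \<noteq> 0"
      "F x = (\<Sum>m\<in>T. fps_const (c m) * fps_monomial F m)"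
      using fps_algebra_hull_representation[OF x] by blast
    have xT: "{#x#} \<notin> T" using T(2)[of "{#x#}"] by auto
    \<comment> \<open>The representation of \<open>F x\<close> by the other generators becomes a
      relation: the monomial \<open>{#x#}\<close>, absent from \<open>T\<close>, gets the
      coefficient -1.\<close>
    define c' where "c' = c({#x#} := - 1)"
    have "(\<Sum>m\<in>insert {#x#} T. fps_const (c' m) * fps_monomial F m) =
        fps_const (- 1) * fps_monomial F {#x#} + (\<Sum>m\<in>T. fps_const (c m) * fps_monomial F m)"
      using T(1) xT by (auto simp: c'_def intro!: sum.cong arg_cong2[of _ _ _ _ "(+)"])
    also have "\<dots> = 0"
      by (subst T(3)[symmetric]) (simp add: fps_monomial_def flip: fps_const_neg)
    finally have "(\<Sum>m\<in>insert {#x#} T. fps_const (c' m) * fps_monomial F m) = 0" .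
    moreover have "(\<Sum>m\<in>insert {#x#} T. fps_const (c' m) * fps_monomial F m) \<notin> I \<union> {0}"
      using T(1,2) by (intro free) (auto simp: c'_def)
    ultimately show False by simp
  qed
  have inj: "inj F"
  proof (rule injI, rule ccontr)
    fix x y assume *: "F x = F y" "x \<noteq> y"
    then have "F x \<in> F ` (- {x})" by auto
    then show False using indep[of x] hull_inc by metis
  qed
  have "minimal_generators (range F) C"
    unfolding minimal_generators_def
  proof (intro conjI allI impI notI)
    fix T assume T: "T \<subset> range F" "fps_algebra hull T = C"
    then obtain x where x: "F x \<notin> T" by blast
    then have "T \<subseteq> F ` (- {x})" using T(1) by auto
    then have "C \<subseteq> fps_algebra hull (F ` (- {x}))" using T(2) hull_mono by metis
    moreover have "F x \<in> C" unfolding C_def by (rule hull_inc) auto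
    ultimately show False using indep by blast
  qed (simp add: C_def)
  moreover have "range F \<approx> (UNIV :: 'v set)"
    using inj by (simp add: inj_on_image_eqpoll_self)
  ultimately have "generated_by_card (UNIV :: 'v set) C" unfolding generated_by_card_def by blast
  then show ?thesis
    unfolding algebrable_in_def
    using A CA CI fps_algebra_hull[of "range F"] unfolding C_def by blast
qed

lemma E_Beurling_subset_Roumieu: "E_Beurling \<sigma> U \<subseteq> E_Roumieu \<sigma> U"
  unfolding E_Beurling_def E_Roumieu_def using zero_less_one by blast

lemma E0_Beurling_subset_Roumieu: "E0_Beurling \<sigma> \<subseteq> E0_Roumieu \<sigma>"
  unfolding E0_Beurling_def E0_Roumieu_def using E_Beurling_subset_Roumieu by blast

text \<open>Common core of the two cases: the space enters only through the parameters
  \<open>l k\<close> whose bounds put a lacunary series into \<open>A\<close>, and \<open>I\<close>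
  may be the image of the germs of either type.\<close>

lemma algebrable_lacunary:
  assumes S: "\<sigma> \<in> weight_class" "quasianalytic \<sigma>" and W: "\<omega> \<in> weight_class"
    and small: "\<And>\<epsilon>. \<epsilon> > 0 \<Longrightarrow> \<exists>\<^sub>F t in at_top. \<omega> t \<le> \<epsilon> * t"
    and l: "\<And>k. l k > 0"
    and A: "fps_algebra A" "\<And>n a. strict_mono n \<Longrightarrow>
      (\<And>k. norm (a k) * fact (n k) \<le> weight_seq \<omega> (l k) (n k)) \<Longrightarrow> lacunary n a \<in> A"
    and I: "I \<subseteq> borel_map ` E0_Roumieu \<sigma>"
  shows "algebrable_in (UNIV :: real set) A (A - I)"
proof -
  obtain n :: "nat \<Rightarrow> nat" where n0: "0 < n 0" and n: "\<And>k. Suc k * n k < n (Suc k)"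
    and gap: "\<And>k. long_gap (weight_seq \<sigma> (Suc k)) (Suc (Suc k * n k)) (n (Suc k))"
    and growth: "\<And>k. real k ^ n k * fact (n k) \<le> weight_seq \<omega> (l k) (n k)"
    using ex_lacunary_exponents[OF S W, of l] small l by blast
  have "n k < n (Suc k)" for k using n[of k] by simp
  then have mono: "strict_mono n" by (rule strict_monoI_Suc)
  obtain u :: "nat \<Rightarrow> real \<Rightarrow> nat" where u: "\<And>B w. finite B \<Longrightarrow> \<exists>\<^sub>\<infinity>k. \<forall>x\<in>B. u k x = w x"
    using independent_family by blast
  define F :: "real \<Rightarrow> complex fps"
    where "F = (\<lambda>x. lacunary n (\<lambda>k. of_real (real k ^ n k) * (1 / (1 + of_nat (u k x)))))"
  show ?thesis
  proof (rule algebrable_inI[OF A(1), of F])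
    fix x
    show "F x \<in> A"
      unfolding F_def
    proof (rule A(2)[OF mono])
      fix k
      have "norm (1 + of_nat (u k x) :: complex) = 1 + real (u k x)"
        by (metis norm_of_nat of_nat_Suc)
      then have "norm (1 / (1 + of_nat (u k x)) :: complex) \<le> 1"
        by (simp add: norm_divide)
      then have "norm (of_real (real k ^ n k) * (1 / (1 + of_nat (u k x))) :: complex) \<le> real k ^ n k"
        unfolding norm_mult using mult_left_le[of "norm (1 / (1 + of_nat (u k x)) :: complex)" "real k ^ n k"]
        by (simp add: norm_power)
      then have "norm (of_real (real k ^ n k) * (1 / (1 + of_nat (u k x))) :: complex) * fact (n k) \<le>
          real k ^ n k * fact (n k)"
        by (intro mult_right_mono) auto
      also have "\<dots> \<le> weight_seq \<omega> (l k) (n k)" by (rule growth)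
      finally show "norm (of_real (real k ^ n k) * (1 / (1 + of_nat (u k x))) :: complex) * fact (n k) \<le>
          weight_seq \<omega> (l k) (n k)" .
    qed
  next
    fix T and c :: "real multiset \<Rightarrow> complex"
    assume T: "finite T" "T \<noteq> {}" "\<And>m. m \<in> T \<Longrightarrow> m \<noteq> {#} \<and> c m \<noteq> 0"
    define G where "G = (\<Sum>m\<in>T. fps_const (c m) * fps_monomial F m)"
    have "\<exists>d\<ge>1. \<exists>\<kappa>>0. (\<forall>k\<ge>d. \<forall>j. d * n k < j \<longrightarrow> j < n (Suc k) \<longrightarrow> fps_nth G j = 0) \<and>
        (\<exists>\<^sub>\<infinity>k. norm (fps_nth G (d * n k)) \<ge> \<kappa> * real k ^ (d * n k))"
      unfolding G_def F_def by (rule lacunary_polynomial_growth[OF n0 n]) (fact u T)+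
    then obtain d \<kappa> where d: "d \<ge> 1" "\<kappa> > 0"
      and van: "\<And>k j. k \<ge> d \<Longrightarrow> d * n k < j \<Longrightarrow> j < n (Suc k) \<Longrightarrow> fps_nth G j = 0"
      and large: "\<exists>\<^sub>\<infinity>k. norm (fps_nth G (d * n k)) \<ge> \<kappa> * real k ^ (d * n k)"
      by blast
    have "G \<notin> borel_map ` E0_Roumieu \<sigma>"
      by (rule not_borel_image[OF S(1) n0 n gap d]) (fact van large)+
    then have "G \<notin> I" using I by blast
    moreover have "G \<noteq> 0"
    proof
      assume "G = 0"
      moreover obtain k where "k > 0" "norm (fps_nth G (d * n k)) \<ge> \<kappa> * real k ^ (d * n k)"
        using large unfolding INFM_nat by blast
      moreover have "\<kappa> * real k ^ (d * n k) > 0" using d \<open>k > 0\<close> by simp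
      ultimately show False by simp
    qed
    ultimately show "(\<Sum>m\<in>T. fps_const (c m) * fps_monomial F m) \<notin> I \<union> {0}"
      by (simp add: G_def)
  qed
qed

text \<open>The lower limit 0 gives \<open>\<omega> t \<le> \<epsilon> * t\<close> for arbitrarily
  large \<open>t\<close>; the constant parameter 1 suffices for membership.\<close>

lemma algebrable_F_Roumieu:
  assumes S: "\<sigma> \<in> weight_class" "quasianalytic \<sigma>" and W: "\<omega> \<in> weight_class"
    and lim: "Liminf at_top (\<lambda>t. ereal (\<omega> t / t)) = 0"
    and I: "I \<subseteq> borel_map ` E0_Roumieu \<sigma>"
  shows "algebrable_in (UNIV :: real set) (F_Roumieu \<omega>) (F_Roumieu \<omega> - I)"
proof (rule algebrable_lacunary[OF S W, where l = "\<lambda>_. 1"])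
  fix \<epsilon> :: real assume \<epsilon>: "\<epsilon> > 0"
  show "\<exists>\<^sub>F t in at_top. \<omega> t \<le> \<epsilon> * t"
  proof (rule ccontr)
    assume "\<not> (\<exists>\<^sub>F t in at_top. \<omega> t \<le> \<epsilon> * t)"
    then have "\<forall>\<^sub>F t in at_top. \<epsilon> * t < \<omega> t" by (simp add: not_frequently not_le)
    then have "\<forall>\<^sub>F t in at_top. ereal \<epsilon> \<le> ereal (\<omega> t / t)"
      using eventually_gt_at_top[of 0] by eventually_elim (simp add: field_simps)
    then have "ereal \<epsilon> \<le> Liminf at_top (\<lambda>t. ereal (\<omega> t / t))" by (rule Liminf_bounded)
    then show False using lim \<epsilon> by simp
  qed
next
  show "fps_algebra (F_Roumieu \<omega>)" by (rule fps_algebra_F_Roumieu[OF W])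
next
  fix n :: "nat \<Rightarrow> nat" and a :: "nat \<Rightarrow> complex"
  assume "strict_mono n" "\<And>k. norm (a k) * fact (n k) \<le> weight_seq \<omega> 1 (n k)"
  then have "coeff_bound \<omega> 1 (lacunary n a)"
    by (intro lacunary_coeff_bound[OF W, where l = "\<lambda>_. 1" and K = 0]) auto
  then show "lacunary n a \<in> F_Roumieu \<omega>" unfolding F_Roumieu_def using zero_less_one by blast
qed (use I in auto)

text \<open>The parameters \<open>1 / Suc k\<close> tend to 0, so every \<open>l > 0\<close>
  dominates them from some \<open>K\<close> on, and the generators satisfy all Beurling
  bounds.\<close>

lemma algebrable_F_Beurling:
  assumes S: "\<sigma> \<in> weight_class" "quasianalytic \<sigma>" and W: "\<omega> \<in> weight_class"
    and lim: "\<omega> \<in> o[at_top](\<lambda>t. t)"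
    and I: "I \<subseteq> borel_map ` E0_Roumieu \<sigma>"
  shows "algebrable_in (UNIV :: real set) (F_Beurling \<omega>) (F_Beurling \<omega> - I)"
proof (rule algebrable_lacunary[OF S W, where l = "\<lambda>k. 1 / real (Suc k)"])
  fix \<epsilon> :: real assume \<epsilon>: "\<epsilon> > 0"
  have "\<forall>\<^sub>F t in at_top. norm (\<omega> t) \<le> \<epsilon> * norm t" using landau_o.smallD[OF lim \<epsilon>] .
  then have "\<forall>\<^sub>F t in at_top. \<omega> t \<le> \<epsilon> * t"
    using eventually_gt_at_top[of 0] by eventually_elim auto
  then show "\<exists>\<^sub>F t in at_top. \<omega> t \<le> \<epsilon> * t"
    by (rule eventually_frequently[rotated]) simp
next
  show "fps_algebra (F_Beurling \<omega>)" by (rule fps_algebra_F_Beurling[OF W])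
next
  fix n :: "nat \<Rightarrow> nat" and a :: "nat \<Rightarrow> complex"
  assume *: "strict_mono n" "\<And>k. norm (a k) * fact (n k) \<le> weight_seq \<omega> (1 / real (Suc k)) (n k)"
  have "coeff_bound \<omega> l (lacunary n a)" if l: "l > 0" for l
  proof -
    obtain K where K: "1 / real (Suc K) < l" using nat_approx_posE[OF l] by blast
    have "1 / real (Suc k) \<le> l" if "k \<ge> K" for k
    proof -
      have "1 / real (Suc k) \<le> 1 / real (Suc K)" using that by (intro divide_left_mono) auto
      then show ?thesis using K by linarith
    qed
    then show ?thesis
      using * by (intro lacunary_coeff_bound[OF W, where l = "\<lambda>k. 1 / real (Suc k)" and K = K]) auto
  qed
  then show "lacunary n a \<in> F_Beurling \<omega>" unfolding F_Beurling_def by blast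
qed (use I in auto)

theorem theorem3p12:
  fixes \<sigma> \<omega> :: "real \<Rightarrow> real"
  assumes "\<sigma> \<in> weight_class" and "quasianalytic \<sigma>"
    and "\<omega> \<in> weight_class" and "quasianalytic \<omega>"
  shows "(\<omega> \<in> O[at_top](\<lambda>t. t) \<and> Liminf at_top (\<lambda>t. ereal (\<omega> t / t)) = 0 \<longrightarrow>
      algebrable_in (UNIV :: real set) (F_Roumieu \<omega>) (F_Roumieu \<omega> - borel_map ` E0_Roumieu \<sigma>) \<and>
      algebrable_in (UNIV :: real set) (F_Roumieu \<omega>) (F_Roumieu \<omega> - borel_map ` E0_Beurling \<sigma>)) \<and>
    (\<omega> \<in> o[at_top](\<lambda>t. t) \<longrightarrow>
      algebrable_in (UNIV :: real set) (F_Beurling \<omega>) (F_Beurling \<omega> - borel_map ` E0_Roumieu \<sigma>) \<and>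
      algebrable_in (UNIV :: real set) (F_Beurling \<omega>) (F_Beurling \<omega> - borel_map ` E0_Beurling \<sigma>))"
  using assms(1-3) image_mono[OF E0_Beurling_subset_Roumieu, of borel_map \<sigma>]
  by (blast intro: algebrable_F_Roumieu algebrable_F_Beurling)

end
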